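(* Let $U$ be a neighborhood of the origin $o\in\mathbb{R}^2$ and let $h:U\to\mathbb{L}^3$ be a $C^\infty$-differentiable time-like surface which has no umbilics on $U\setminus\{o\}$. If there exists a $C^1$-differentiable curvature line flow $\mathcal{F}$ on $U\setminus\{o\}$ whose index at $o$ is $n/2\in\frac12\mathbb{Z}$, then $\mathcal{F}$ canonically induces another curvature line flow $\mathcal{F}^\perp$ (satisfying $(\mathcal{F}^\perp)^\perp=\mathcal{F}$) whose index at $o$ is $-n/2$. Moreover, if $\mathcal{F}$ is $C^r$-differentiable ($r\ge1$), then so is $\mathcal{F}^\perp$.
   Context: $\mathbb{L}^3$ is the Lorentz-Minkowski 3-space, i.e. $\mathbb{R}^3$ with the inner product $x_1y_1+x_2y_2-x_3y_3$ (signature $(++-)$). A time-like surface is an immersion $h:U\to\mathbb{L}^3$ whose induced metric is Lorentzian. With $\nu$ a unit normal field ($\nu\cdot\nu=1$), the shape operator $A_h$ is defined by $d\nu=-dh\circ A_h$. An umbilic is a point where $A_h$ is a scalar multiple of the identity; a quasi-umbilic is a point where the characteristic equation of $A_h$ has a double root but $A_h$ is not diagonalizable. A principal direction is a (real) eigen-direction of $A_h$. A curvature line flow on $U\setminus\{o\}$ is the flow (foliation) generated by a continuous field of principal directions (1-dimensional tangent subspaces) on $U\setminus\{o\}$. It is $C^1$-differentiable when it is generated by a continuous direction field (so its leaves are $C^1$ curves); more generally, a $C^r$-differentiable flow ($r\ge 1$) is one generated by a $C^{r-1}$ direction field. The index at $o$ is the total variation of the angle of the direction along a small counterclockwise circle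 around $o$, divided by $2\pi$, an element of $\frac12\mathbb{Z}$. The flow $\mathcal{F}^\perp$: after a congruence of $\mathbb{L}^3$ and a change of coordinates, near $o$ the surface is written in time-like Ribaucour's parametrization $$h(\xi,\eta)=(0,\xi,\eta)-\mu\,\nu+\mu\,(1,0,0),\qquad \nu=\frac{1}{-1-\mu_\xi^2+\mu_\eta^2}\left(1-\mu_\xi^2+\mu_\eta^2,\,-2\mu_\xi,\,2\mu_\eta\right)$$ with a $C^\infty$-function $\mu$ satisfying $\mu(o)=\mu_\xi(o)=\mu_\eta(o)=0$. If $\mathcal{F}$ is locally generated by $u\,\partial_\xi+v\,\partial_\eta$, then $\mathcal{F}^\perp$ is the flow generated by $v\,\partial_\xi+u\,\partial_\eta$. Equivalently, the direction of $\mathcal{F}^\perp$ at each point is the orthogonal complement, with respect to the induced Lorentzian metric, of the direction of $\mathcal{F}$: it is the other principal direction if there are two, and the same one at a quasi-umbilic. (So "another" does not exclude that $\mathcal{F}^\perp$ and $\mathcal{F}$ have the same direction at quasi-umbilics.) *)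

theory Defs
  imports "HOL-Analysis.Analysis" "HOL-Library.Extended_Nat"
begin

text \<open>Differentiability classes, only meaningful on open sets \<open>S\<close>.\<close>

primrec k_times_continuously_differentiable_on ::
  "nat \<Rightarrow> ('a::real_normed_vector \<Rightarrow> 'b::real_normed_vector) \<Rightarrow> 'a set \<Rightarrow> bool" where
  "k_times_continuously_differentiable_on 0 f S \<longleftrightarrow> continuous_on S f"
| "k_times_continuously_differentiable_on (Suc k) f S \<longleftrightarrow>
     (\<forall>x\<in>S. f differentiable (at x)) \<and>
     (\<forall>v. k_times_continuously_differentiable_on k (\<lambda>x. frechet_derivative f (at x) v) S)"

definition C_on ::
  "enat \<Rightarrow> ('a::real_normed_vector \<Rightarrow> 'b::real_normed_vector) \<Rightarrow> 'a set \<Rightarrow> bool" where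
  "C_on r f S \<longleftrightarrow> (\<forall>k. enat k \<le> r \<longrightarrow> k_times_continuously_differentiable_on k f S)"

definition lorentz :: "real^3 \<Rightarrow> real^3 \<Rightarrow> real" where
  "lorentz x y = x$1 * y$1 + x$2 * y$2 - x$3 * y$3"

definition lorentz_congruence :: "(real^3 \<Rightarrow> real^3) \<Rightarrow> bool" where
  "lorentz_congruence T \<longleftrightarrow>
     (\<exists>L c. linear L \<and> (\<forall>x y. lorentz (L x) (L y) = lorentz x y) \<and> T = (\<lambda>x. L x + c))"

definition induced_metric ::
  "(real^2 \<Rightarrow> real^3) \<Rightarrow> real^2 \<Rightarrow> real^2 \<Rightarrow> real^2 \<Rightarrow> real" where
  "induced_metric h p v w =
     lorentz (frechet_derivative h (at p) v) (frechet_derivative h (at p) w)"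

text \<open>The last conjunct says that the induced metric has signature \<open>(+-)\<close>.\<close>

definition timelike_surface :: "(real^2 \<Rightarrow> real^3) \<Rightarrow> (real^2) set \<Rightarrow> bool" where
  "timelike_surface h U \<longleftrightarrow>
     C_on \<infinity> h U \<and>
     (\<forall>p\<in>U. inj (frechet_derivative h (at p)) \<and>
       (\<exists>a b. induced_metric h p a a = 1 \<and> induced_metric h p b b = -1 \<and>
              induced_metric h p a b = 0))"

definition unit_normal_field ::
  "(real^2 \<Rightarrow> real^3) \<Rightarrow> (real^2 \<Rightarrow> real^3) \<Rightarrow> (real^2) set \<Rightarrow> bool" where
  "unit_normal_field h \<nu> U \<longleftrightarrow>
     C_on \<infinity> \<nu> U \<and>
     (\<forall>p\<in>U. lorentz (\<nu> p) (\<nu> p) = 1 \<and>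
       (\<forall>v. lorentz (\<nu> p) (frechet_derivative h (at p) v) = 0))"

text \<open>For an immersion \<open>h\<close> with unit normal field \<open>\<nu>\<close> the operator below exists and is unique.\<close>

definition shape_operator ::
  "(real^2 \<Rightarrow> real^3) \<Rightarrow> (real^2 \<Rightarrow> real^3) \<Rightarrow> real^2 \<Rightarrow> real^2 \<Rightarrow> real^2" where
  "shape_operator h \<nu> p =
     (THE A. linear A \<and>
       (\<forall>v. frechet_derivative \<nu> (at p) v = - frechet_derivative h (at p) (A v)))"

definition umbilic :: "(real^2 \<Rightarrow> real^3) \<Rightarrow> (real^2 \<Rightarrow> real^3) \<Rightarrow> real^2 \<Rightarrow> bool" where
  "umbilic h \<nu> p \<longleftrightarrow> (\<exists>c. \<forall>v. shape_operator h \<nu> p v = c *\<^sub>R v)"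

definition eigenvector_of :: "(real^2 \<Rightarrow> real^2) \<Rightarrow> real^2 \<Rightarrow> bool" where
  "eigenvector_of A v \<longleftrightarrow> v \<noteq> 0 \<and> (\<exists>c. A v = c *\<^sub>R v)"

definition quasi_umbilic :: "(real^2 \<Rightarrow> real^3) \<Rightarrow> (real^2 \<Rightarrow> real^3) \<Rightarrow> real^2 \<Rightarrow> bool" where
  "quasi_umbilic h \<nu> p \<longleftrightarrow>
     (let A = shape_operator h \<nu> p in
       (\<exists>c. \<forall>x. det (x *\<^sub>R mat 1 - matrix A) = (x - c)\<^sup>2) \<and>
       \<not> (\<exists>B. (\<forall>v\<in>B. eigenvector_of A v) \<and> independent B \<and> span B = UNIV))"

definition principal_direction ::
  "(real^2 \<Rightarrow> real^3) \<Rightarrow> (real^2 \<Rightarrow> real^3) \<Rightarrow> real^2 \<Rightarrow> (real^2) set \<Rightarrow> bool" where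
  "principal_direction h \<nu> p l \<longleftrightarrow>
     (\<exists>v. eigenvector_of (shape_operator h \<nu> p) v \<and> l = span {v})"

text \<open>Direction fields assign to each point a line through \<open>0\<close> in the tangent space. They need
  not be orientable, so a generating vector field is only required locally.\<close>

definition C_direction_field :: "enat \<Rightarrow> (real^2 \<Rightarrow> (real^2) set) \<Rightarrow> (real^2) set \<Rightarrow> bool" where
  "C_direction_field r F S \<longleftrightarrow>
     (\<forall>p\<in>S. \<exists>V X. open V \<and> p \<in> V \<and> V \<subseteq> S \<and> C_on r X V \<and>
        (\<forall>q\<in>V. X q \<noteq> 0 \<and> F q = span {X q}))"

text \<open>A flow is represented by the direction field that generates it; for \<open>r \<ge> 1\<close> a flow is
  \<open>C\<^sup>r\<close> when that field is of class \<open>C\<close> to the power \<open>r - 1\<close>.\<close>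

definition C_curvature_line_flow ::
  "enat \<Rightarrow> (real^2 \<Rightarrow> real^3) \<Rightarrow> (real^2 \<Rightarrow> real^3) \<Rightarrow> (real^2) set \<Rightarrow>
    (real^2 \<Rightarrow> (real^2) set) \<Rightarrow> bool" where
  "C_curvature_line_flow r h \<nu> S F \<longleftrightarrow>
     C_direction_field (r - 1) F S \<and> (\<forall>p\<in>S. principal_direction h \<nu> p (F p))"

text \<open>Here \<open>\<theta>\<close> is a continuous angle of the direction along the circle. Two such choices
  differ by a constant in \<open>\<pi>\<int>\<close>, so the total variation does not depend on the choice.\<close>

definition has_index :: "(real^2 \<Rightarrow> (real^2) set) \<Rightarrow> real^2 \<Rightarrow> real \<Rightarrow> bool" where
  "has_index F p i \<longleftrightarrow>
     (\<exists>\<epsilon>>0. \<forall>\<rho>. 0 < \<rho> \<and> \<rho> < \<epsilon> \<longrightarrow>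
       (\<exists>\<theta>::real \<Rightarrow> real. continuous_on {0..2 * pi} \<theta> \<and>
          (\<forall>t\<in>{0..2 * pi}.
             F (p + \<rho> *\<^sub>R vector [cos t, sin t]) = span {vector [cos (\<theta> t), sin (\<theta> t)]}) \<and>
          (\<theta> (2 * pi) - \<theta> 0) / (2 * pi) = i))"

definition perp_flow ::
  "(real^2 \<Rightarrow> real^3) \<Rightarrow> (real^2 \<Rightarrow> (real^2) set) \<Rightarrow> real^2 \<Rightarrow> (real^2) set" where
  "perp_flow h F p = {w. \<forall>v\<in>F p. induced_metric h p v w = 0}"

definition ribaucour_denominator :: "(real^2 \<Rightarrow> real) \<Rightarrow> real^2 \<Rightarrow> real" where
  "ribaucour_denominator \<mu> p =
     (let a = frechet_derivative \<mu> (at p) (axis 1 1); b = frechet_derivative \<mu> (at p) (axis 2 1)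
      in - 1 - a\<^sup>2 + b\<^sup>2)"

definition ribaucour_normal :: "(real^2 \<Rightarrow> real) \<Rightarrow> real^2 \<Rightarrow> real^3" where
  "ribaucour_normal \<mu> p =
     (let a = frechet_derivative \<mu> (at p) (axis 1 1); b = frechet_derivative \<mu> (at p) (axis 2 1)
      in (1 / ribaucour_denominator \<mu> p) *\<^sub>R vector [1 - a\<^sup>2 + b\<^sup>2, - 2 * a, 2 * b])"

definition ribaucour_surface :: "(real^2 \<Rightarrow> real) \<Rightarrow> real^2 \<Rightarrow> real^3" where
  "ribaucour_surface \<mu> p =
     vector [0, p$1, p$2] - \<mu> p *\<^sub>R ribaucour_normal \<mu> p + \<mu> p *\<^sub>R vector [1, 0, 0]"

text \<open>\<open>T\<close> is the congruence of Minkowski space and \<open>\<phi>\<close> the change of coordinates that bring the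
  surface \<open>h\<close>, near the origin, into time-like Ribaucour form with function \<open>\<mu>\<close>.\<close>

definition ribaucour_parametrization ::
  "(real^2 \<Rightarrow> real^3) \<Rightarrow> (real^2) set \<Rightarrow> (real^3 \<Rightarrow> real^3) \<Rightarrow> (real^2) set \<Rightarrow>
    (real^2 \<Rightarrow> real^2) \<Rightarrow> (real^2 \<Rightarrow> real) \<Rightarrow> bool" where
  "ribaucour_parametrization h U T V \<phi> \<mu> \<longleftrightarrow>
     lorentz_congruence T \<and> open V \<and> 0 \<in> V \<and>
     C_on \<infinity> \<phi> V \<and> inj_on \<phi> V \<and> (\<forall>p\<in>V. inj (frechet_derivative \<phi> (at p))) \<and>
     \<phi> ` V \<subseteq> U \<and> \<phi> 0 = 0 \<and>
     C_on \<infinity> \<mu> V \<and> \<mu> 0 = 0 \<and> (\<forall>v. frechet_derivative \<mu> (at 0) v = 0) \<and>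
     (\<forall>p\<in>V. ribaucour_denominator \<mu> p \<noteq> 0 \<and> T (h (\<phi> p)) = ribaucour_surface \<mu> p)"

end

theory Submission
  imports Defs
begin

text \<open>If \<open>g\<close> is the induced metric and \<open>J\<close> the rotation by a right angle, the \<open>g\<close>-orthogonal complement
  of \<open>span {X}\<close> is \<open>span {J g X}\<close>; since \<open>g\<close> is smooth, this direction field is as smooth as \<open>X\<close>. The
  shape operator is \<open>g\<close>-self-adjoint, so it maps the complement of an eigenvector to itself, and the
  complement is again principal; it is the same direction exactly if the direction is null, which
  forces a double eigenvalue. As \<open>det g < 0\<close>, the real-linear map \<open>J g\<close> is dominated by its conjugate-linear
  part, hence reverses the winding of directions. In Ribaucour's parametrization the differentials of
  the surface and of its normal are \<open>P (1 - \<mu> N)\<close> and \<open>P N\<close>, with \<open>P\<close> an isometry from the plane with metric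
  \<open>d\<xi>\<^sup>2 - d\<eta>\<^sup>2\<close> and \<open>N\<close> self-adjoint for that metric; so a principal direction
  \<open>(u, v)\<close> is orthogonal to \<open>(v, u)\<close> for the induced metric as well.\<close>

section \<open>Differentiability classes\<close>

text \<open>As \<open>S\<close> is open, functions equal on \<open>S\<close> agree near each of its
  points and so have the same derivatives there. Inside the recursion a derivative can thus be
  replaced by a formula valid on \<open>S\<close> only.\<close>

lemma k_times_continuously_differentiable_on_cong:
  assumes "open S" "\<And>x. x \<in> S \<Longrightarrow> f x = g x"
    and "k_times_continuously_differentiable_on k f S"
  shows "k_times_continuously_differentiable_on k g S"
  using assms(2,3)
proof (induction k arbitrary: f g)
  case 0
  then show ?case
    by (simp add: continuous_on_eq)
next
  case (Suc k)
  have D: "(g has_derivative frechet_derivative f (at x)) (at x)" if "x \<in> S" for x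
  proof -
    have "(f has_derivative frechet_derivative f (at x)) (at x)"
      using Suc.prems(2) that by (simp add: frechet_derivative_works[symmetric])
    then show ?thesis
      by (rule has_derivative_transform_within_open[OF _ \<open>open S\<close> that]) (use Suc.prems(1) in auto)
  qed
  have "k_times_continuously_differentiable_on k (\<lambda>x. frechet_derivative g (at x) v) S" for v
  proof (rule Suc.IH)
    show "frechet_derivative f (at x) v = frechet_derivative g (at x) v" if "x \<in> S" for x
      using frechet_derivative_at[OF D[OF that]] by (rule fun_cong)
    show "k_times_continuously_differentiable_on k (\<lambda>x. frechet_derivative f (at x) v) S"
      using Suc.prems(2) by simp
  qed
  moreover have "g differentiable (at x)" if "x \<in> S" for x
    using D[OF that] by (rule differentiableI)
  ultimately show ?case
    by simp
qed

lemma k_times_continuously_differentiable_on_SucD: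
  assumes "k_times_continuously_differentiable_on (Suc k) f S"
  shows "k_times_continuously_differentiable_on k f S"
  using assms
proof (induction k arbitrary: f)
  case 0
  then have "f differentiable_on S"
    by (auto simp: differentiable_on_def intro: differentiable_at_withinI)
  then show ?case
    by (simp add: differentiable_imp_continuous_on)
next
  case (Suc k)
  from Suc.prems have "k_times_continuously_differentiable_on k (\<lambda>x. frechet_derivative f (at x) v) S" for v
    by (intro Suc.IH) (simp only: k_times_continuously_differentiable_on.simps(2)[of "Suc k" f])
  with Suc.prems show ?case
    by simp
qed

lemma k_times_continuously_differentiable_on_const:
  "k_times_continuously_differentiable_on k (\<lambda>x. c) S"
  by (induction k arbitrary: c) (auto simp: frechet_derivative_const)

lemma k_times_continuously_differentiable_on_add:
  assumes "open S"
    and "k_times_continuously_differentiable_on k f S"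
    and "k_times_continuously_differentiable_on k g S"
  shows "k_times_continuously_differentiable_on k (\<lambda>x. f x + g x) S"
  using assms(2,3)
proof (induction k arbitrary: f g)
  case 0
  then show ?case
    by (simp add: continuous_on_add)
next
  case (Suc k)
  have E: "frechet_derivative (\<lambda>x. f x + g x) (at x) v =
      frechet_derivative f (at x) v + frechet_derivative g (at x) v" if "x \<in> S" for x v
  proof -
    have "((\<lambda>x. f x + g x) has_derivative
        (\<lambda>v. frechet_derivative f (at x) v + frechet_derivative g (at x) v)) (at x)"
      using Suc.prems that by (intro has_derivative_add) (simp_all add: frechet_derivative_works[symmetric])
    then show ?thesis
      by (metis frechet_derivative_at)
  qed
  have "k_times_continuously_differentiable_on k
      (\<lambda>x. frechet_derivative f (at x) v + frechet_derivative g (at x) v) S" for v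
    using Suc.prems by (intro Suc.IH) auto
  then have "k_times_continuously_differentiable_on k (\<lambda>x. frechet_derivative (\<lambda>x. f x + g x) (at x) v) S" for v
    by (rule k_times_continuously_differentiable_on_cong[OF \<open>open S\<close>, rotated]) (rule E[symmetric])
  with Suc.prems show ?case
    by auto
qed

lemma (in bounded_bilinear) frechet_derivative:
  assumes "f differentiable (at x)" "g differentiable (at x)"
  shows "frechet_derivative (\<lambda>x. prod (f x) (g x)) (at x) v =
    prod (f x) (frechet_derivative g (at x) v) + prod (frechet_derivative f (at x) v) (g x)"
proof -
  have "((\<lambda>x. prod (f x) (g x)) has_derivative
      (\<lambda>v. prod (f x) (frechet_derivative g (at x) v) + prod (frechet_derivative f (at x) v) (g x))) (at x)"
    using assms by (intro FDERIV) (simp_all add: frechet_derivative_works[symmetric])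
  then show ?thesis
    by (metis frechet_derivative_at)
qed

lemma (in bounded_bilinear) differentiable:
  assumes "f differentiable (at x)" "g differentiable (at x)"
  shows "(\<lambda>x. prod (f x) (g x)) differentiable (at x)"
  using assms FDERIV unfolding differentiable_def by blast

text \<open>The Leibniz rule, once for all products used later: multiplication, scaling, the inner
  product and \<open>lorentz\<close>.\<close>

lemma (in bounded_bilinear) k_times_continuously_differentiable_on:
  assumes "open S"
    and "k_times_continuously_differentiable_on k f S"
    and "k_times_continuously_differentiable_on k g S"
  shows "k_times_continuously_differentiable_on k (\<lambda>x. prod (f x) (g x)) S"
  using assms(2,3)
proof (induction k arbitrary: f g)
  case 0
  then show ?case
    by (simp add: continuous_on)
next
  case (Suc k)
  have D: "f differentiable (at x)" "g differentiable (at x)" if "x \<in> S" for x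
    using Suc.prems that by auto
  \<comment> \<open>Each Leibniz term pairs an undifferentiated factor, of order
    \<open>Suc k\<close>, with a derivative of order \<open>k\<close>; the induction hypothesis
    wants both at order \<open>k\<close>.\<close>
  note lower = Suc.prems[THEN k_times_continuously_differentiable_on_SucD]
  have "k_times_continuously_differentiable_on k
      (\<lambda>x. prod (f x) (frechet_derivative g (at x) v) + prod (frechet_derivative f (at x) v) (g x)) S" for v
    using \<open>open S\<close> Suc.prems lower
    by (intro k_times_continuously_differentiable_on_add Suc.IH) auto
  then have "k_times_continuously_differentiable_on k (\<lambda>x. frechet_derivative (\<lambda>x. prod (f x) (g x)) (at x) v) S" for v
    by (rule k_times_continuously_differentiable_on_cong[OF \<open>open S\<close>, rotated])
      (rule frechet_derivative[symmetric, OF D])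
  moreover have "(\<lambda>x. prod (f x) (g x)) differentiable (at x)" if "x \<in> S" for x
    using D[OF that] by (rule differentiable)
  ultimately show ?case
    by simp
qed

lemma C_on_cong:
  assumes "open S" "\<And>x. x \<in> S \<Longrightarrow> f x = g x" "C_on r f S"
  shows "C_on r g S"
  using assms k_times_continuously_differentiable_on_cong[of S f g] unfolding C_on_def by blast

lemma C_on_mono:
  assumes "C_on r f S" "s \<le> r"
  shows "C_on s f S"
  using assms order_trans unfolding C_on_def by blast

lemma C_on_subset:
  assumes "C_on r f S" "T \<subseteq> S"
  shows "C_on r f T"
proof -
  have "k_times_continuously_differentiable_on k f T" if "k_times_continuously_differentiable_on k f S" for k
    using that \<open>T \<subseteq> S\<close> by (induction k arbitrary: f) (auto intro: continuous_on_subset)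
  with assms show ?thesis
    unfolding C_on_def by blast
qed

lemma C_on_const: "C_on r (\<lambda>x. c) S"
  by (simp add: C_on_def k_times_continuously_differentiable_on_const)

lemma C_on_add:
  assumes "open S" "C_on r f S" "C_on r g S"
  shows "C_on r (\<lambda>x. f x + g x) S"
  using assms unfolding C_on_def by (blast intro: k_times_continuously_differentiable_on_add)

lemma (in bounded_bilinear) C_on:
  assumes "open S" "C_on r f S" "C_on r g S"
  shows "C_on r (\<lambda>x. prod (f x) (g x)) S"
  using assms unfolding C_on_def by (blast intro: k_times_continuously_differentiable_on)

lemma C_on_continuous_on:
  assumes "C_on r f S"
  shows "continuous_on S f"
  using assms unfolding C_on_def
  by (metis k_times_continuously_differentiable_on.simps(1) zero_enat_def zero_le)

lemma C_on_differentiable: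
  assumes "C_on r f S" "1 \<le> r" "x \<in> S"
  shows "f differentiable (at x)"
proof -
  have "k_times_continuously_differentiable_on (Suc 0) f S"
    using assms unfolding C_on_def by (metis One_nat_def one_enat_def)
  with assms show ?thesis
    by simp
qed

lemma C_on_frechet_derivative:
  assumes "C_on \<infinity> f S"
  shows "C_on \<infinity> (\<lambda>x. frechet_derivative f (at x) v) S"
  unfolding C_on_def
proof (intro allI impI)
  fix k
  have "k_times_continuously_differentiable_on (Suc k) f S"
    using assms unfolding C_on_def by (metis enat_ord_code(3))
  then show "k_times_continuously_differentiable_on k (\<lambda>x. frechet_derivative f (at x) v) S"
    by simp
qed

lemma C_on_inner_right:
  fixes f :: "'a::real_normed_vector \<Rightarrow> 'b::real_inner"
  assumes "open S" "C_on r f S"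
  shows "C_on r (\<lambda>x. f x \<bullet> c) S"
  using assms by (intro bounded_bilinear.C_on[OF bounded_bilinear_inner] C_on_const)

section \<open>Symmetry of second derivatives\<close>

text \<open>The mean value theorem is used twice: along \<open>v\<close> for the increment of
  \<open>f\<close> over \<open>s *\<^sub>R w\<close>, then along \<open>w\<close> for the resulting
  derivative. The second difference itself is symmetric in \<open>v\<close> and
  \<open>w\<close>.\<close>

lemma second_difference_mean_value:
  fixes f :: "'a::real_normed_vector \<Rightarrow> real"
  assumes "0 < s"
    and box: "\<And>a b. \<lbrakk>0 \<le> a; a \<le> s; 0 \<le> b; b \<le> s\<rbrakk> \<Longrightarrow> x + a *\<^sub>R v + b *\<^sub>R w \<in> S"
    and f: "\<And>y. y \<in> S \<Longrightarrow> f differentiable (at y)"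
    and g: "\<And>y. y \<in> S \<Longrightarrow> (\<lambda>y. frechet_derivative f (at y) v) differentiable (at y)"
  obtains a b where "0 \<le> a" "a \<le> s" "0 \<le> b" "b \<le> s"
    "f (x + s *\<^sub>R v + s *\<^sub>R w) - f (x + s *\<^sub>R v) - f (x + s *\<^sub>R w) + f x
      = s\<^sup>2 * frechet_derivative (\<lambda>y. frechet_derivative f (at y) v) (at (x + a *\<^sub>R v + b *\<^sub>R w)) w"
proof -
  have line: "((\<lambda>t. F (y + t *\<^sub>R u)) has_derivative (\<lambda>d. d * frechet_derivative F (at (y + t *\<^sub>R u)) u))
      (at t within T)"
    if "F differentiable (at (y + t *\<^sub>R u))" for F :: "'a \<Rightarrow> real" and y u t T
  proof -
    let ?D = "frechet_derivative F (at (y + t *\<^sub>R u))"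
    have D: "(F has_derivative ?D) (at (y + t *\<^sub>R u))"
      using that by (simp add: frechet_derivative_works[symmetric])
    have "((\<lambda>t. F (y + t *\<^sub>R u)) has_derivative (\<lambda>d. ?D (d *\<^sub>R u))) (at t within T)"
      by (rule has_derivative_compose[of "\<lambda>t. y + t *\<^sub>R u" _ _ _ F, OF _ D]) (auto intro!: derivative_eq_intros)
    moreover have "?D (d *\<^sub>R u) = d * ?D u" for d
      using linear_scale[OF has_derivative_linear[OF D]] by simp
    ultimately show ?thesis
      by simp
  qed
  let ?g = "\<lambda>y. frechet_derivative f (at y) v"
  have swap: "x + a *\<^sub>R v + b *\<^sub>R w = (x + b *\<^sub>R w) + a *\<^sub>R v" for a b
    by simp
  have "\<exists>a\<in>{0<..<s}. (f (x + s *\<^sub>R w + s *\<^sub>R v) - f (x + s *\<^sub>R v)) - (f (x + s *\<^sub>R w + 0 *\<^sub>R v) - f (x + 0 *\<^sub>R v))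
      = (s - 0) * ?g (x + s *\<^sub>R w + a *\<^sub>R v) - (s - 0) * ?g (x + a *\<^sub>R v)"
  proof (rule mvt_simple[OF \<open>0 < s\<close>])
    fix t assume t: "0 \<le> t" "t \<le> s"
    have "f differentiable (at (x + s *\<^sub>R w + t *\<^sub>R v))" "f differentiable (at (x + t *\<^sub>R v))"
      using f[OF box[of t s]] f[OF box[of t 0]] t \<open>0 < s\<close> by (simp_all add: swap)
    then show "((\<lambda>t. f (x + s *\<^sub>R w + t *\<^sub>R v) - f (x + t *\<^sub>R v)) has_derivative
        (\<lambda>d. d * ?g (x + s *\<^sub>R w + t *\<^sub>R v) - d * ?g (x + t *\<^sub>R v))) (at t within {0..s})"
      by (intro has_derivative_diff line)
  qed
  then obtain a where a: "0 < a" "a < s"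
    "(f (x + s *\<^sub>R w + s *\<^sub>R v) - f (x + s *\<^sub>R v)) - (f (x + s *\<^sub>R w + 0 *\<^sub>R v) - f (x + 0 *\<^sub>R v))
      = (s - 0) * ?g (x + s *\<^sub>R w + a *\<^sub>R v) - (s - 0) * ?g (x + a *\<^sub>R v)"
    by (auto simp only: greaterThanLessThan_iff)
  then have \<Delta>: "f (x + s *\<^sub>R v + s *\<^sub>R w) - f (x + s *\<^sub>R v) - f (x + s *\<^sub>R w) + f x
      = s * (?g (x + a *\<^sub>R v + s *\<^sub>R w) - ?g (x + a *\<^sub>R v))"
    by (simp add: swap[of s s] swap[of a s] right_diff_distrib)
  have "\<exists>b\<in>{0<..<s}. ?g (x + a *\<^sub>R v + s *\<^sub>R w) - ?g (x + a *\<^sub>R v + 0 *\<^sub>R w)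
      = (s - 0) * frechet_derivative ?g (at (x + a *\<^sub>R v + b *\<^sub>R w)) w"
  proof (rule mvt_simple[OF \<open>0 < s\<close>])
    fix t assume "0 \<le> t" "t \<le> s"
    then show "((\<lambda>t. ?g (x + a *\<^sub>R v + t *\<^sub>R w)) has_derivative
        (\<lambda>d. d * frechet_derivative ?g (at (x + a *\<^sub>R v + t *\<^sub>R w)) w)) (at t within {0..s})"
      using a by (intro line g box) auto
  qed
  then obtain b where "0 < b" "b < s" "?g (x + a *\<^sub>R v + s *\<^sub>R w) - ?g (x + a *\<^sub>R v)
      = s * frechet_derivative ?g (at (x + a *\<^sub>R v + b *\<^sub>R w)) w"
    by auto
  with a \<Delta> show thesis
    by (intro that[of a b]) (simp_all add: power2_eq_square)
qed

text \<open>One second difference is \<open>s\<^sup>2\<close> times either mixed derivative at some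
  point of a small parallelogram; by continuity both are close to their values at \<open>x\<close>,
  so these cannot differ.\<close>

lemma second_derivative_symmetric_real:
  fixes f :: "'a::real_normed_vector \<Rightarrow> real"
  assumes "open S" "x \<in> S" and f: "C_on \<infinity> f S"
  shows "frechet_derivative (\<lambda>y. frechet_derivative f (at y) v) (at x) w =
    frechet_derivative (\<lambda>y. frechet_derivative f (at y) w) (at x) v"
proof (rule ccontr)
  define D where "D v w y = frechet_derivative (\<lambda>y. frechet_derivative f (at y) v) (at y) w" for v w y
  assume neq: "\<not> ?thesis"
  \<comment> \<open>Half the supposed gap: two values within \<open>e\<close> of a common number are
    less than the whole gap apart.\<close>
  define e where "e = \<bar>D v w x - D w v x\<bar> / 2"
  have e: "0 < e"
    using neq by (simp add: D_def e_def)
  have diff: "f differentiable (at y)" "(\<lambda>y. frechet_derivative f (at y) u) differentiable (at y)"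
    if "y \<in> S" for y u
    using C_on_differentiable[OF f _ that] C_on_differentiable[OF C_on_frechet_derivative[OF f] _ that]
    by simp_all
  have "isCont (D u u') x" for u u'
    using C_on_continuous_on[OF C_on_frechet_derivative[OF C_on_frechet_derivative[OF f]]] \<open>open S\<close> \<open>x \<in> S\<close>
    by (auto simp: D_def[abs_def] continuous_on_eq_continuous_at)
  then have "\<forall>\<^sub>F y in nhds x. dist (D u u' y) (D u u' x) < e" for u u'
    using tendstoD[of "D u u'" "D u u' x" "nhds x" e] e
    by (simp add: isCont_def tendsto_nhds_iff)
  then have "\<forall>\<^sub>F y in nhds x. dist (D v w y) (D v w x) < e \<and> dist (D w v y) (D w v x) < e \<and> y \<in> S"
    using eventually_nhds_in_open[OF \<open>open S\<close> \<open>x \<in> S\<close>] by (simp add: eventually_conj)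
  then obtain d where d: "0 < d"
    "\<And>y. dist y x < d \<Longrightarrow> dist (D v w y) (D v w x) < e \<and> dist (D w v y) (D w v x) < e \<and> y \<in> S"
    unfolding eventually_nhds_metric by blast
  \<comment> \<open>Small enough to keep the parallelogram within \<open>d\<close> of
    \<open>x\<close>; the summand 1 keeps the denominator positive even for
    \<open>v = w = 0\<close>.\<close>
  define s where "s = d / (2 * (norm v + norm w + 1))"
  have pos: "norm v + norm w + 1 > 0"
    using norm_ge_zero[of v] norm_ge_zero[of w] by linarith
  then have "s > 0"
    using \<open>0 < d\<close> by (simp add: s_def)
  have near: "dist (x + a *\<^sub>R v + b *\<^sub>R w) x < d" if "0 \<le> a" "a \<le> s" "0 \<le> b" "b \<le> s" for a b
  proof -
    have "norm (a *\<^sub>R v + b *\<^sub>R w) \<le> a * norm v + b * norm w"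
      using norm_triangle_ineq[of "a *\<^sub>R v" "b *\<^sub>R w"] that by simp
    also have "\<dots> \<le> s * norm v + s * norm w"
      using that by (intro add_mono mult_right_mono) auto
    also have "\<dots> \<le> s * (norm v + norm w + 1)"
      using \<open>s > 0\<close> by (simp add: algebra_simps)
    also have "\<dots> < d"
      using pos \<open>0 < d\<close> by (simp add: s_def field_simps add_pos_nonneg)
    finally show ?thesis
      by (simp add: dist_norm add.assoc)
  qed
  obtain a b where ab: "0 \<le> a" "a \<le> s" "0 \<le> b" "b \<le> s"
    "f (x + s *\<^sub>R v + s *\<^sub>R w) - f (x + s *\<^sub>R v) - f (x + s *\<^sub>R w) + f x = s\<^sup>2 * D v w (x + a *\<^sub>R v + b *\<^sub>R w)"
    using near d(2) diff \<open>s > 0\<close> unfolding D_def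
    by (rule_tac second_difference_mean_value[of s x v w S f]) auto
  obtain a' b' where ab': "0 \<le> a'" "a' \<le> s" "0 \<le> b'" "b' \<le> s"
    "f (x + s *\<^sub>R w + s *\<^sub>R v) - f (x + s *\<^sub>R w) - f (x + s *\<^sub>R v) + f x = s\<^sup>2 * D w v (x + a' *\<^sub>R w + b' *\<^sub>R v)"
  proof (rule second_difference_mean_value[of s x w v S f, folded D_def])
    show "x + a *\<^sub>R w + b *\<^sub>R v \<in> S" if "0 \<le> a" "a \<le> s" "0 \<le> b" "b \<le> s" for a b
      using near[of b a] d(2) that by (simp add: add_ac)
  qed (use \<open>s > 0\<close> diff in auto)
  have "s\<^sup>2 * D v w (x + a *\<^sub>R v + b *\<^sub>R w) = s\<^sup>2 * D w v (x + a' *\<^sub>R w + b' *\<^sub>R v)"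
    using ab(5) ab'(5) by (simp add: algebra_simps)
  then have "D v w (x + a *\<^sub>R v + b *\<^sub>R w) = D w v (x + a' *\<^sub>R w + b' *\<^sub>R v)"
    using \<open>s > 0\<close> by simp
  moreover have "dist (D v w (x + a *\<^sub>R v + b *\<^sub>R w)) (D v w x) < e"
    using d(2) near ab by blast
  moreover have "dist (D w v (x + a' *\<^sub>R w + b' *\<^sub>R v)) (D w v x) < e"
    using d(2) near[of b' a'] ab' by (simp add: add_ac)
  ultimately have "dist (D v w x) (D w v x) < \<bar>D v w x - D w v x\<bar>"
    unfolding e_def by (metis dist_triangle_half_r)
  then show False
    by (simp add: dist_real_def)
qed

text \<open>Reduction to real functions: the inner product with a fixed vector commutes with both
  differentiations.\<close>

lemma second_derivative_symmetric:
  fixes f :: "'a::real_normed_vector \<Rightarrow> 'b::euclidean_space"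
  assumes "open S" "x \<in> S" and f: "C_on \<infinity> f S"
  shows "frechet_derivative (\<lambda>y. frechet_derivative f (at y) v) (at x) w =
    frechet_derivative (\<lambda>y. frechet_derivative f (at y) w) (at x) v"
proof (rule euclidean_eqI)
  fix c :: 'b
  have inner: "frechet_derivative (\<lambda>y. g y \<bullet> c) (at z) u = frechet_derivative g (at z) u \<bullet> c"
    if "g differentiable (at z)" for g :: "'a \<Rightarrow> 'b" and z u
    using that bounded_bilinear.frechet_derivative[OF bounded_bilinear_inner, of g z "\<lambda>_. c" u]
    by (simp add: frechet_derivative_const)
  have diff: "f differentiable (at y)" "(\<lambda>y. frechet_derivative f (at y) u) differentiable (at y)"
    if "y \<in> S" for y u
    using C_on_differentiable[OF f _ that] C_on_differentiable[OF C_on_frechet_derivative[OF f] _ that]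
    by simp_all
  have "frechet_derivative (\<lambda>y. frechet_derivative (\<lambda>y. f y \<bullet> c) (at y) v) (at x) w =
      frechet_derivative (\<lambda>y. frechet_derivative f (at y) v) (at x) w \<bullet> c" for v w
  proof -
    \<comment> \<open>The first derivative has to be rewritten at all points near \<open>x\<close>
      before it is differentiated again; openness of \<open>S\<close> provides this.\<close>
    have "frechet_derivative (\<lambda>y. frechet_derivative f (at y) v \<bullet> c) (at x)
        = frechet_derivative (\<lambda>y. frechet_derivative (\<lambda>y. f y \<bullet> c) (at y) v) (at x)"
    proof (rule frechet_derivative_transform_within_open[OF _ \<open>open S\<close> \<open>x \<in> S\<close>])
      show "(\<lambda>y. frechet_derivative f (at y) v \<bullet> c) differentiable (at x)"
        using diff \<open>x \<in> S\<close> by simp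
    qed (use diff inner in auto)
    then show ?thesis
      using inner diff \<open>x \<in> S\<close> by metis
  qed
  with second_derivative_symmetric_real[OF assms(1,2) C_on_inner_right[OF assms(1) f]]
  show "frechet_derivative (\<lambda>y. frechet_derivative f (at y) v) (at x) w \<bullet> c =
    frechet_derivative (\<lambda>y. frechet_derivative f (at y) w) (at x) v \<bullet> c"
    by metis
qed

section \<open>Lorentzian forms on the plane\<close>

lemma vec2_decompose: "(x::real^2) = x$1 *\<^sub>R axis 1 1 + x$2 *\<^sub>R axis 2 1"
  by (simp add: vec_eq_iff forall_2 axis_def)

lemma span_pair_UNIV:
  fixes v w :: "real^2"
  assumes "v \<noteq> 0" "w \<notin> span {v}"
  shows "independent {w, v}" "span {w, v} = UNIV"
proof -
  show ind: "independent {w, v}"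
    using assms by (simp add: independent_insert)
  have "w \<noteq> v"
    using assms span_base by auto
  then have "card {w, v} = dim (UNIV :: (real^2) set)"
    by simp
  then show "span {w, v} = UNIV"
    using card_eq_dim[of "{w, v}" UNIV] ind by auto
qed

lemma span_singleton_eq:
  fixes v w :: "'a::real_vector"
  assumes "w \<in> span {v}" "w \<noteq> 0"
  shows "span {w} = span {v}"
proof -
  obtain k where k: "w = k *\<^sub>R v"
    using assms(1) by (auto simp: span_singleton)
  with assms(2) have "v = (1 / k) *\<^sub>R w"
    by auto
  moreover have "(1 / k) *\<^sub>R w \<in> span {w}"
    by (simp add: span_base span_scale)
  ultimately have "v \<in> span {w}"
    by simp
  with assms(1) show ?thesis
    by (simp add: span_eq)
qed

text \<open>The vector representing the functional \<open>g v\<close> in the Euclidean inner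
  product, turned counterclockwise by a right angle.\<close>

definition perp_vector :: "(real^2 \<Rightarrow> real^2 \<Rightarrow> real) \<Rightarrow> real^2 \<Rightarrow> real^2" where
  "perp_vector g v = vector [- g v (axis 2 1), g v (axis 1 1)]"

text \<open>For a symmetric form on the plane, signature (+-) amounts to a negative Gram
  determinant.\<close>

locale lorentzian_form =
  fixes g :: "real^2 \<Rightarrow> real^2 \<Rightarrow> real"
  assumes bilinear: "bilinear g"
    and commute: "g v w = g w v"
    and det_neg: "g (axis 1 1) (axis 1 1) * g (axis 2 1) (axis 2 1) < (g (axis 1 1) (axis 2 1))\<^sup>2"
begin

sublocale bounded_bilinear g
  using bilinear bilinear_conv_bounded_bilinear by blast

lemma expand_right: "g v w = w$1 * g v (axis 1 1) + w$2 * g v (axis 2 1)"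
  by (subst vec2_decompose[of w]) (simp only: add_right scaleR_right real_scaleR_def)

lemma expand_left: "g v w = v$1 * g (axis 1 1) w + v$2 * g (axis 2 1) w"
  by (subst vec2_decompose[of v]) (simp only: add_left scaleR_left real_scaleR_def)

text \<open>The matrix of \<open>perp_vector g\<close> is a quarter turn times a symmetric matrix,
  so its trace is zero and its determinant is the Gram determinant. By Cayley-Hamilton its square is
  minus that determinant, a positive scalar.\<close>

lemma perp_vector_perp_vector:
  "perp_vector g (perp_vector g v) =
    ((g (axis 1 1) (axis 2 1))\<^sup>2 - g (axis 1 1) (axis 1 1) * g (axis 2 1) (axis 2 1)) *\<^sub>R v"
  by (simp add: perp_vector_def vec_eq_iff forall_2 expand_left[of v] expand_left[of "vector _"]
      commute[of "axis 2 1" "axis 1 1"] power2_eq_square algebra_simps)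

lemma perp_vector_nonzero:
  assumes "v \<noteq> 0"
  shows "perp_vector g v \<noteq> 0"
proof
  assume "perp_vector g v = 0"
  moreover have "perp_vector g 0 = 0"
    by (simp add: perp_vector_def vec_eq_iff forall_2 zero_left)
  ultimately have "((g (axis 1 1) (axis 2 1))\<^sup>2 - g (axis 1 1) (axis 1 1) * g (axis 2 1) (axis 2 1)) *\<^sub>R v = 0"
    using perp_vector_perp_vector[of v] by simp
  then show False
    using det_neg assms by simp
qed

lemma orthogonal_perp_vector: "g v (perp_vector g v) = 0"
  by (simp add: expand_right[of v "vector _"] perp_vector_def)

lemma complement_eq_span:
  assumes "v \<noteq> 0"
  shows "{w. g v w = 0} = span {perp_vector g v}"
proof
  let ?a = "g v (axis 1 1)" and ?b = "g v (axis 2 1)"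
  have "?a \<noteq> 0 \<or> ?b \<noteq> 0"
    using perp_vector_nonzero[OF assms] by (auto simp: perp_vector_def vec_eq_iff forall_2)
  then have pos: "?a\<^sup>2 + ?b\<^sup>2 \<noteq> 0"
    by (simp add: sum_power2_eq_zero_iff)
  show "{w. g v w = 0} \<subseteq> span {perp_vector g v}"
  proof
    fix w assume "w \<in> {w. g v w = 0}"
    then have w: "w$1 * ?a + w$2 * ?b = 0"
      using expand_right[of v w] by simp
    \<comment> \<open>The coefficient of the Euclidean projection of \<open>w\<close> to the line of
      \<open>perp_vector g v\<close>.\<close>
    define k where "k = (w$2 * ?a - w$1 * ?b) / (?a\<^sup>2 + ?b\<^sup>2)"
    then have k: "k * (?a\<^sup>2 + ?b\<^sup>2) = w$2 * ?a - w$1 * ?b"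
      using pos by simp
    \<comment> \<open>With the denominator cleared, the defect in each coordinate is a multiple of
      \<open>g v w\<close>, which is zero.\<close>
    have "(w$1 + k * ?b) * (?a\<^sup>2 + ?b\<^sup>2) = w$1 * (?a\<^sup>2 + ?b\<^sup>2) + ?b * (k * (?a\<^sup>2 + ?b\<^sup>2))"
      by (simp add: algebra_simps)
    also have "\<dots> = ?a * (w$1 * ?a + w$2 * ?b)"
      unfolding k by (simp add: power2_eq_square algebra_simps)
    finally have 1: "w$1 + k * ?b = 0"
      using pos by (simp only: w mult_zero_right mult_eq_0_iff simp_thms)
    have "(w$2 - k * ?a) * (?a\<^sup>2 + ?b\<^sup>2) = w$2 * (?a\<^sup>2 + ?b\<^sup>2) - ?a * (k * (?a\<^sup>2 + ?b\<^sup>2))"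
      by (simp add: algebra_simps)
    also have "\<dots> = ?b * (w$1 * ?a + w$2 * ?b)"
      unfolding k by (simp add: power2_eq_square algebra_simps)
    finally have 2: "w$2 - k * ?a = 0"
      using pos by (simp only: w mult_zero_right mult_eq_0_iff simp_thms)
    have "w = k *\<^sub>R perp_vector g v"
      using 1 2 by (simp add: perp_vector_def vec_eq_iff forall_2)
    then show "w \<in> span {perp_vector g v}"
      by (auto simp: span_singleton)
  qed
  show "span {perp_vector g v} \<subseteq> {w. g v w = 0}"
    by (auto simp: span_singleton scaleR_right orthogonal_perp_vector)
qed

lemma complement_of_span:
  assumes "v \<noteq> 0"
  shows "{w. \<forall>x\<in>span {v}. g x w = 0} = span {perp_vector g v}"
proof -
  have "{w. \<forall>x\<in>span {v}. g x w = 0} = {w. g v w = 0}"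
    using span_base[of v "{v}"] by (auto simp: span_singleton scaleR_left)
  with complement_eq_span[OF assms] show ?thesis
    by simp
qed

section \<open>Operators self-adjoint for a Lorentzian form\<close>

context
  fixes A :: "real^2 \<Rightarrow> real^2"
  assumes linear_A: "linear A" and selfadjoint: "g (A v) w = g v (A w)"
begin

lemma eigenvector_perp_vector:
  assumes "eigenvector_of A v"
  shows "eigenvector_of A (perp_vector g v)"
proof -
  from assms obtain c where "v \<noteq> 0" and c: "A v = c *\<^sub>R v"
    unfolding eigenvector_of_def by blast
  have "g v (A (perp_vector g v)) = c * g v (perp_vector g v)"
    by (simp add: selfadjoint[symmetric] c scaleR_left)
  then have "A (perp_vector g v) \<in> span {perp_vector g v}"
    using complement_eq_span[OF \<open>v \<noteq> 0\<close>] orthogonal_perp_vector by auto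
  with perp_vector_nonzero[OF \<open>v \<noteq> 0\<close>] show ?thesis
    unfolding eigenvector_of_def by (auto simp: span_singleton)
qed

text \<open>Otherwise \<open>v\<close> and \<open>perp_vector g v\<close> would be a basis of
  eigenvectors.\<close>

lemma perp_vector_dependent_if_not_diagonalizable:
  assumes "eigenvector_of A v"
    and "\<not> (\<exists>B. (\<forall>v\<in>B. eigenvector_of A v) \<and> independent B \<and> span B = UNIV)"
  shows "perp_vector g v \<in> span {v}"
proof (rule ccontr)
  assume "perp_vector g v \<notin> span {v}"
  then have "independent {perp_vector g v, v}" "span {perp_vector g v, v} = UNIV"
    using assms(1) span_pair_UNIV by (auto simp: eigenvector_of_def)
  moreover have "\<forall>w\<in>{perp_vector g v, v}. eigenvector_of A w"
    using assms(1) eigenvector_perp_vector[OF assms(1)] by simp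
  ultimately show False
    using assms(2) by (metis (no_types))
qed

text \<open>Eigenvectors for distinct eigenvalues are orthogonal, but the complement of a null
  vector is its own line, on which only \<open>c\<close> occurs.\<close>

lemma eigenvalue_unique_if_null:
  assumes "v \<noteq> 0" "A v = c *\<^sub>R v" "perp_vector g v \<in> span {v}" "w \<noteq> 0" "A w = d *\<^sub>R w"
  shows "d = c"
proof (rule ccontr)
  assume "d \<noteq> c"
  have "c * g v w = d * g v w"
    using selfadjoint[of v w] assms by (simp add: scaleR_left scaleR_right)
  with \<open>d \<noteq> c\<close> have "g v w = 0"
    by simp
  then have "w \<in> span {perp_vector g v}"
    using complement_eq_span[OF \<open>v \<noteq> 0\<close>] by auto
  then have "w \<in> span {v}"
    using span_singleton_eq[OF assms(3) perp_vector_nonzero] \<open>v \<noteq> 0\<close> by auto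
  then obtain k where "w = k *\<^sub>R v"
    by (auto simp: span_singleton)
  then have "A w = c *\<^sub>R w"
    using linear_scale[OF linear_A] assms(2) by simp
  with assms \<open>d \<noteq> c\<close> show False
    by simp
qed

text \<open>An eigenbasis would have the eigenvalue \<open>c\<close> throughout and make
  \<open>A\<close> scalar.\<close>

lemma not_diagonalizable_if_null:
  assumes "v \<noteq> 0" "A v = c *\<^sub>R v" "perp_vector g v \<in> span {v}"
    and "\<not> (\<exists>c. \<forall>v. A v = c *\<^sub>R v)"
  shows "\<not> (\<exists>B. (\<forall>v\<in>B. eigenvector_of A v) \<and> independent B \<and> span B = UNIV)"
proof
  assume "\<exists>B. (\<forall>v\<in>B. eigenvector_of A v) \<and> independent B \<and> span B = UNIV"
  then obtain B where B: "\<forall>v\<in>B. eigenvector_of A v" "span B = UNIV"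
    by blast
  then have "A w = c *\<^sub>R w" if "w \<in> B" for w
    using that eigenvalue_unique_if_null[OF assms(1-3)] unfolding eigenvector_of_def by metis
  then have "A w = c *\<^sub>R w" for w
    using linear_eq_on[OF linear_A linear_scale_self, of w B c] B(2) by auto
  with assms(4) show False
    by blast
qed

text \<open>Besides \<open>c\<close> there is the real root trace minus \<open>c\<close>; as an
  eigenvalue with an eigenvector of its own it must equal \<open>c\<close>.\<close>

lemma charpoly_double_root_if_null:
  assumes "v \<noteq> 0" "A v = c *\<^sub>R v" "perp_vector g v \<in> span {v}"
    and "\<not> (\<exists>c. \<forall>v. A v = c *\<^sub>R v)"
  shows "det (x *\<^sub>R mat 1 - matrix A) = (x - c)\<^sup>2"
proof -
  define a b p q where "a = A (axis 1 1) $ 1" and "b = A (axis 2 1) $ 1"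
    and "p = A (axis 1 1) $ 2" and "q = A (axis 2 1) $ 2"
  have A: "A u = vector [u$1 * a + u$2 * b, u$1 * p + u$2 * q]" for u
    by (subst vec2_decompose[of u]) (simp add: linear_add[OF linear_A] linear_scale[OF linear_A]
        vec_eq_iff forall_2 a_def b_def p_def q_def)
  have v: "(a - c) * v$1 + b * v$2 = 0" "p * v$1 + (q - c) * v$2 = 0"
    using assms(2) unfolding A by (simp_all add: vec_eq_iff forall_2 algebra_simps)
  \<comment> \<open>Multiplying the eigenvector equation by the adjugate matrix shows that the
    determinant of \<open>A - c\<close> annihilates \<open>v\<close>.\<close>
  have "((a - c) * (q - c) - b * p) * v$1 = (q - c) * ((a - c) * v$1 + b * v$2) - b * (p * v$1 + (q - c) * v$2)"
    "((a - c) * (q - c) - b * p) * v$2 = (a - c) * (p * v$1 + (q - c) * v$2) - p * ((a - c) * v$1 + b * v$2)"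
    by (simp_all add: algebra_simps)
  then have root: "(a - c) * (q - c) = b * p"
    using \<open>v \<noteq> 0\<close> by (auto simp: v vec_eq_iff forall_2)
  \<comment> \<open>By Cayley-Hamilton \<open>A - c\<close> maps into the eigenspace of the other root \<open>a + q - c\<close>.\<close>
  obtain u where "A u \<noteq> c *\<^sub>R u"
    using assms(4) by blast
  moreover have "A (A u - c *\<^sub>R u) = (a + q - c) *\<^sub>R (A u - c *\<^sub>R u) + (b * p - (a - c) * (q - c)) *\<^sub>R u"
    by (simp add: A vec_eq_iff forall_2 algebra_simps)
  then have "A (A u - c *\<^sub>R u) = (a + q - c) *\<^sub>R (A u - c *\<^sub>R u)"
    by (simp add: root)
  ultimately have "a + q - c = c"
    using eigenvalue_unique_if_null[OF assms(1-3), of "A u - c *\<^sub>R u"] by simp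
  then have q: "q = 2 * c - a"
    by simp
  have "det (x *\<^sub>R mat 1 - matrix A) = (x - a) * (x - q) - b * p"
    by (simp add: det_2 matrix_def mat_def a_def b_def p_def q_def)
  also have "\<dots> = (x - c)\<^sup>2"
    unfolding root[symmetric] q by (simp add: power2_eq_square algebra_simps)
  finally show ?thesis .
qed

end

end

section \<open>Surfaces in Minkowski space\<close>

lemma bounded_bilinear_lorentz: "bounded_bilinear lorentz"
  unfolding bilinear_conv_bounded_bilinear[symmetric] bilinear_def lorentz_def
  by (auto intro!: linearI simp: algebra_simps)

interpretation lorentz: bounded_bilinear lorentz
  by (rule bounded_bilinear_lorentz)

lemma lorentz_commute: "lorentz x y = lorentz y x"
  by (simp add: lorentz_def)

lemma lorentz_nondegenerate:
  assumes "\<And>y. lorentz x y = 0"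
  shows "x = 0"
  using assms[of "axis 1 1"] assms[of "axis 2 1"] assms[of "axis 3 1"]
  by (simp add: lorentz_def axis_def vec_eq_iff forall_3)

text \<open>An inclusion of two planes: the kernel of a nonzero functional contains the image of an
  injective linear map from the plane.\<close>

lemma range_eq_lorentz_complement:
  fixes f :: "real^2 \<Rightarrow> real^3"
  assumes "linear f" "inj f" "n \<noteq> 0" and ortho: "\<And>v. lorentz n (f v) = 0"
  shows "range f = {x. lorentz n x = 0}"
proof -
  \<comment> \<open>The vector representing \<open>lorentz n\<close> in the Euclidean inner
    product.\<close>
  let ?n = "vector [n$1, n$2, - n$3] :: real^3"
  have "lorentz n x = ?n \<bullet> x" for x
    by (simp add: lorentz_def inner_vec_def sum_3)
  moreover have "?n \<noteq> 0"
    using \<open>n \<noteq> 0\<close> by (simp add: vec_eq_iff forall_3)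
  ultimately have "dim {x. lorentz n x = 0} = 2"
    by (simp add: dim_hyperplane)
  moreover have "dim (range f) = 2"
    using dim_image_eq[of f UNIV] assms by simp
  moreover have "subspace (range f)" "subspace {x. lorentz n x = 0}"
    using linear_subspace_image[OF assms(1) subspace_UNIV]
    by (auto simp: subspace_def lorentz.add_right lorentz.scaleR_right lorentz.zero_right)
  ultimately show ?thesis
    using ortho by (intro subspace_dim_equal) auto
qed

text \<open>Serves to differentiate identities that hold on an open set: those of the unit normal,
  and later that of a sign squaring to 1.\<close>

lemma has_derivative_of_constant_eq_zero:
  assumes "(f has_derivative f') (at p)" "open S" "p \<in> S" "\<And>q. q \<in> S \<Longrightarrow> f q = c"
  shows "f' v = 0"
proof -
  have "((\<lambda>_. c) has_derivative f') (at p)"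
    using assms by (rule has_derivative_transform_within_open)
  then have "f' = (\<lambda>_. 0)"
    using has_derivative_const has_derivative_unique by blast
  then show ?thesis
    by simp
qed

locale oriented_timelike_surface =
  fixes h \<nu> :: "real^2 \<Rightarrow> real^3" and U :: "(real^2) set"
  assumes open_domain: "open U"
    and timelike: "timelike_surface h U"
    and normal: "unit_normal_field h \<nu> U"
begin

lemma smooth: "C_on \<infinity> h U" "C_on \<infinity> \<nu> U"
  using timelike normal by (auto simp: timelike_surface_def unit_normal_field_def)

lemma has_derivative:
  assumes "p \<in> U"
  shows "(h has_derivative frechet_derivative h (at p)) (at p)"
    "(\<nu> has_derivative frechet_derivative \<nu> (at p)) (at p)"
    "((\<lambda>q. frechet_derivative h (at q) w) has_derivative
      frechet_derivative (\<lambda>q. frechet_derivative h (at q) w) (at p)) (at p)"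
  using smooth[THEN C_on_differentiable, OF _ assms]
    C_on_differentiable[OF C_on_frechet_derivative[OF smooth(1)] _ assms]
  by (simp_all add: frechet_derivative_works[symmetric])

lemma linear_derivative:
  assumes "p \<in> U"
  shows "linear (frechet_derivative h (at p))" "linear (frechet_derivative \<nu> (at p))"
  using assms has_derivative has_derivative_linear by blast+

lemma inj_derivative:
  assumes "p \<in> U"
  shows "inj (frechet_derivative h (at p))"
  using assms timelike by (auto simp: timelike_surface_def)

lemma lorentz_normal:
  assumes "p \<in> U"
  shows "lorentz (\<nu> p) (\<nu> p) = 1" "lorentz (\<nu> p) (frechet_derivative h (at p) v) = 0"
  using assms normal by (auto simp: unit_normal_field_def)

lemma range_derivative:
  assumes "p \<in> U"
  shows "range (frechet_derivative h (at p)) = {x. lorentz (\<nu> p) x = 0}"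
proof (rule range_eq_lorentz_complement)
  show "\<nu> p \<noteq> 0"
    using lorentz_normal(1)[OF assms] lorentz.zero_left[of 0] by auto
qed (use assms linear_derivative inj_derivative lorentz_normal in auto)

text \<open>Half the derivative of \<open>lorentz (\<nu> p) (\<nu> p) = 1\<close>.\<close>

lemma lorentz_derivative_normal:
  assumes "p \<in> U"
  shows "lorentz (\<nu> p) (frechet_derivative \<nu> (at p) v) = 0"
proof -
  note D = has_derivative[OF assms]
  have "lorentz (\<nu> p) (frechet_derivative \<nu> (at p) v) + lorentz (frechet_derivative \<nu> (at p) v) (\<nu> p) = 0"
    by (rule has_derivative_of_constant_eq_zero[OF lorentz.FDERIV[OF D(2) D(2)] open_domain assms lorentz_normal(1)])
  then show ?thesis
    by (simp add: lorentz_commute)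
qed

text \<open>Comes from differentiating along \<open>v\<close> the orthogonality of
  \<open>\<nu>\<close> to the derivative of \<open>h\<close> along the fixed vector
  \<open>w\<close>.\<close>

lemma lorentz_second_derivative:
  assumes "p \<in> U"
  shows "lorentz (\<nu> p) (frechet_derivative (\<lambda>q. frechet_derivative h (at q) w) (at p) v) =
    - lorentz (frechet_derivative \<nu> (at p) v) (frechet_derivative h (at p) w)"
proof -
  note D = has_derivative[OF assms]
  have "lorentz (\<nu> p) (frechet_derivative (\<lambda>q. frechet_derivative h (at q) w) (at p) v)
      + lorentz (frechet_derivative \<nu> (at p) v) (frechet_derivative h (at p) w) = 0"
    by (rule has_derivative_of_constant_eq_zero[OF lorentz.FDERIV[OF D(2) D(3)] open_domain assms lorentz_normal(2)])
  then show ?thesis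
    by simp
qed

text \<open>The derivative of the normal is tangent, so it lifts through the differential of
  \<open>h\<close>; injectivity makes the lift unique and linear, which justifies the definite
  description.\<close>

lemma shape_operator:
  assumes "p \<in> U"
  shows "linear (shape_operator h \<nu> p)"
    and "frechet_derivative \<nu> (at p) v = - frechet_derivative h (at p) (shape_operator h \<nu> p v)"
proof -
  let ?P = "\<lambda>A. linear A \<and> (\<forall>v. frechet_derivative \<nu> (at p) v = - frechet_derivative h (at p) (A v))"
  note dh = linear_derivative(1)[OF assms] and d\<nu> = linear_derivative(2)[OF assms]
    and inj = inj_derivative[OF assms]
  define A where "A v = (SOME u. frechet_derivative h (at p) u = - frechet_derivative \<nu> (at p) v)" for v
  have A: "frechet_derivative h (at p) (A v) = - frechet_derivative \<nu> (at p) v" for v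
  proof -
    have "- frechet_derivative \<nu> (at p) v \<in> range (frechet_derivative h (at p))"
      using assms by (simp add: range_derivative lorentz_derivative_normal lorentz.minus_right)
    then have "\<exists>u. frechet_derivative h (at p) u = - frechet_derivative \<nu> (at p) v"
      by (metis imageE)
    then show ?thesis
      unfolding A_def by (rule someI_ex)
  qed
  have "linear A"
  proof (rule linearI)
    show "A (x + y) = A x + A y" for x y
      by (rule injD[OF inj]) (simp add: A linear_add[OF dh] linear_add[OF d\<nu>])
    show "A (c *\<^sub>R x) = c *\<^sub>R A x" for c x
      by (rule injD[OF inj]) (simp add: A linear_scale[OF dh] linear_scale[OF d\<nu>])
  qed
  with A have "?P A"
    by simp
  moreover have "B = A" if "?P B" for B
  proof
    show "B v = A v" for v
      using that A[of v] by (intro injD[OF inj]) (metis minus_minus)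
  qed
  ultimately have "?P (shape_operator h \<nu> p)"
    unfolding shape_operator_def by (rule theI[of ?P])
  then show "linear (shape_operator h \<nu> p)"
    "frechet_derivative \<nu> (at p) v = - frechet_derivative h (at p) (shape_operator h \<nu> p v)"
    by auto
qed

text \<open>Both sides equal the second fundamental form \<open>\<nu> \<cdot> D\<^sup>2h\<close>, which is symmetric by Schwarz.\<close>

lemma shape_operator_selfadjoint:
  assumes "p \<in> U"
  shows "induced_metric h p (shape_operator h \<nu> p v) w = induced_metric h p v (shape_operator h \<nu> p w)"
proof -
  have "induced_metric h p (shape_operator h \<nu> p v) w =
      lorentz (\<nu> p) (frechet_derivative (\<lambda>q. frechet_derivative h (at q) w) (at p) v)" for v w
    using lorentz_second_derivative[OF assms] shape_operator(2)[OF assms, of v]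
    by (simp add: induced_metric_def lorentz.minus_left)
  then show ?thesis
    using second_derivative_symmetric[OF open_domain assms smooth(1)]
    by (metis induced_metric_def lorentz_commute)
qed

lemma induced_metric_lorentzian:
  assumes "p \<in> U"
  shows "lorentzian_form (induced_metric h p)"
proof
  note dh = linear_derivative(1)[OF assms]
  show bilinear: "bilinear (induced_metric h p)"
    unfolding bilinear_def induced_metric_def
    by (auto intro!: linearI simp: linear_add[OF dh] linear_scale[OF dh] lorentz.add_left
        lorentz.add_right lorentz.scaleR_left lorentz.scaleR_right)
  show commute: "induced_metric h p v w = induced_metric h p w v" for v w
    by (simp add: induced_metric_def lorentz_commute)
  let ?E = "induced_metric h p (axis 1 1) (axis 1 1)" and ?F = "induced_metric h p (axis 1 1) (axis 2 1)"
    and ?G = "induced_metric h p (axis 2 1) (axis 2 1)"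
  have expand: "induced_metric h p v w = v$1 * w$1 * ?E + (v$1 * w$2 + v$2 * w$1) * ?F + v$2 * w$2 * ?G" for v w
    by (subst vec2_decompose[of v], subst vec2_decompose[of w])
      (simp add: bilinear_ladd[OF bilinear] bilinear_radd[OF bilinear] bilinear_lmul[OF bilinear]
        bilinear_rmul[OF bilinear] commute[of "axis 2 1" "axis 1 1"] algebra_simps)
  obtain a b where ab: "induced_metric h p a a = 1" "induced_metric h p b b = -1" "induced_metric h p a b = 0"
    using timelike assms by (auto simp: timelike_surface_def)
  \<comment> \<open>Gram determinants of two pairs of vectors differ by the squared determinant of
    the change; for \<open>a\<close>, \<open>b\<close> the value is -1.\<close>
  have "(?E * ?G - ?F\<^sup>2) * (a$1 * b$2 - a$2 * b$1)\<^sup>2 =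
      induced_metric h p a a * induced_metric h p b b - (induced_metric h p a b)\<^sup>2"
    unfolding expand[of a a] expand[of b b] expand[of a b] by algebra
  also have "\<dots> < 0"
    using ab by simp
  finally have "?E * ?G - ?F\<^sup>2 < 0"
    by (simp add: mult_less_0_iff not_le)
  then show "?E * ?G < ?F\<^sup>2"
    by simp
qed

end

section \<open>The orthogonal flow\<close>

lemma vector_2_axis: "(vector [a, b] :: real^2) = a *\<^sub>R axis 1 1 + b *\<^sub>R axis 2 1"
  by (simp add: vec_eq_iff forall_2 axis_def)

lemma (in lorentzian_form) perp_vector_expand:
  "perp_vector g v =
    (- (v$1 * g (axis 1 1) (axis 2 1) + v$2 * g (axis 2 1) (axis 2 1))) *\<^sub>R axis 1 1 +
    (v$1 * g (axis 1 1) (axis 1 1) + v$2 * g (axis 2 1) (axis 1 1)) *\<^sub>R axis 2 1"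
  unfolding perp_vector_def vector_2_axis expand_left[of v] ..

context oriented_timelike_surface
begin

lemma C_on_induced_metric: "C_on \<infinity> (\<lambda>q. induced_metric h q a b) U"
  unfolding induced_metric_def
  by (intro lorentz.C_on open_domain C_on_frechet_derivative smooth)

lemma C_on_perp_vector:
  assumes "open V" "V \<subseteq> U" "C_on r X V"
  shows "C_on r (\<lambda>q. perp_vector (induced_metric h q) (X q)) V"
proof -
  \<comment> \<open>The metric is smooth, so only the class of \<open>X\<close> limits the
    result.\<close>
  have metric: "C_on r (\<lambda>q. induced_metric h q a b) V" for a b
    by (rule C_on_mono[OF C_on_subset[OF C_on_induced_metric \<open>V \<subseteq> U\<close>]]) simp
  have component: "C_on r (\<lambda>q. X q $ i) V" for i
    using C_on_inner_right[OF assms(1,3), of "axis i 1"] by (simp add: inner_axis)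
  have m: "C_on r (\<lambda>q. X q $ 1 * induced_metric h q (axis 1 1) b + X q $ 2 * induced_metric h q (axis 2 1) b) V" for b
    by (intro C_on_add bounded_bilinear.C_on[OF bounded_bilinear_mult] metric component \<open>open V\<close>)
  have "C_on r (\<lambda>q. (X q $ 1 * induced_metric h q (axis 1 1) (axis 2 1)
        + X q $ 2 * induced_metric h q (axis 2 1) (axis 2 1)) *\<^sub>R - axis 1 1
      + (X q $ 1 * induced_metric h q (axis 1 1) (axis 1 1)
        + X q $ 2 * induced_metric h q (axis 2 1) (axis 1 1)) *\<^sub>R (axis 2 1 :: real^2)) V"
    by (intro C_on_add bounded_bilinear.C_on[OF bounded_bilinear_scaleR] m C_on_const \<open>open V\<close>)
  then show ?thesis
  proof (rule C_on_cong[OF \<open>open V\<close>, rotated])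
    fix q assume "q \<in> V"
    then interpret lorentzian_form "induced_metric h q"
      using \<open>V \<subseteq> U\<close> induced_metric_lorentzian by blast
    show "(X q $ 1 * induced_metric h q (axis 1 1) (axis 2 1)
        + X q $ 2 * induced_metric h q (axis 2 1) (axis 2 1)) *\<^sub>R - axis 1 1
      + (X q $ 1 * induced_metric h q (axis 1 1) (axis 1 1)
        + X q $ 2 * induced_metric h q (axis 2 1) (axis 1 1)) *\<^sub>R (axis 2 1 :: real^2)
      = perp_vector (induced_metric h q) (X q)"
      unfolding perp_vector_expand scaleR_minus_left scaleR_minus_right ..
  qed
qed

lemma perp_flow_span:
  assumes "p \<in> U" "F p = span {v}" "v \<noteq> 0"
  shows "perp_flow h F p = span {perp_vector (induced_metric h p) v}"
  unfolding perp_flow_def assms(2)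
  by (rule lorentzian_form.complement_of_span[OF induced_metric_lorentzian[OF assms(1)] assms(3)])

text \<open>A local nonvanishing generator of \<open>F\<close> yields one of the complement on the
  same neighbourhood, so no global orientation enters.\<close>

lemma C_direction_field_perp_flow:
  assumes "C_direction_field r F (U - {0})"
  shows "C_direction_field r (perp_flow h F) (U - {0})"
  unfolding C_direction_field_def
proof
  fix p assume "p \<in> U - {0}"
  with assms have "\<exists>V X. open V \<and> p \<in> V \<and> V \<subseteq> U - {0} \<and> C_on r X V \<and>
      (\<forall>q\<in>V. X q \<noteq> 0 \<and> F q = span {X q})"
    unfolding C_direction_field_def by (rule bspec)
  then obtain V X where V: "open V" "p \<in> V" "V \<subseteq> U - {0}" "C_on r X V"
    and X: "\<And>q. q \<in> V \<Longrightarrow> X q \<noteq> 0" "\<And>q. q \<in> V \<Longrightarrow> F q = span {X q}"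
    by auto
  let ?Y = "\<lambda>q. perp_vector (induced_metric h q) (X q)"
  have "?Y q \<noteq> 0 \<and> perp_flow h F q = span {?Y q}" if "q \<in> V" for q
  proof
    have "q \<in> U"
      using that V by blast
    then show "?Y q \<noteq> 0"
      by (intro lorentzian_form.perp_vector_nonzero induced_metric_lorentzian X that)
    show "perp_flow h F q = span {?Y q}"
      by (intro perp_flow_span \<open>q \<in> U\<close> X that)
  qed
  moreover have "C_on r ?Y V"
    using V by (intro C_on_perp_vector) auto
  ultimately show "\<exists>V X. open V \<and> p \<in> V \<and> V \<subseteq> U - {0} \<and> C_on r X V \<and>
      (\<forall>q\<in>V. X q \<noteq> 0 \<and> perp_flow h F q = span {X q})"
    using V(1-3) by (intro exI[of _ V] exI[of _ ?Y]) simp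
qed

section \<open>The orthogonal direction at a single point\<close>

context
  fixes p F
  assumes p: "p \<in> U" and principal: "principal_direction h \<nu> p (F p)"
begin

interpretation lorentzian_form "induced_metric h p"
  by (rule induced_metric_lorentzian[OF p])

lemma principal_direction_perp_flow: "principal_direction h \<nu> p (perp_flow h F p)"
proof -
  obtain v where v: "eigenvector_of (shape_operator h \<nu> p) v" "F p = span {v}"
    using principal unfolding principal_direction_def by blast
  with p show ?thesis
    unfolding principal_direction_def
    by (metis perp_flow_span eigenvector_of_def
        eigenvector_perp_vector[OF shape_operator(1)[OF p] shape_operator_selfadjoint[OF p]])
qed

text \<open>Applying \<open>perp_vector\<close> twice rescales \<open>v\<close> by a nonzero factor
  and keeps the line.\<close>

lemma perp_flow_perp_flow: "perp_flow h (perp_flow h F) p = F p"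
proof -
  obtain v where v: "v \<noteq> 0" "F p = span {v}"
    using principal unfolding principal_direction_def eigenvector_of_def by blast
  let ?w = "perp_vector (induced_metric h p) v"
  have "perp_flow h (perp_flow h F) p = span {perp_vector (induced_metric h p) ?w}"
    by (intro perp_flow_span p v perp_vector_nonzero)
  also have "\<dots> = span {v}"
    using v det_neg
    by (intro span_singleton_eq) (auto simp: perp_vector_perp_vector span_scale span_base)
  finally show ?thesis
    using v by simp
qed

text \<open>The two lines coincide exactly if \<open>v\<close> is null. For a non-scalar operator a
  null eigenvector forces a double root without an eigenbasis, and conversely a missing eigenbasis
  forces nullness.\<close>

lemma perp_flow_eq_iff_quasi_umbilic:
  assumes "\<not> umbilic h \<nu> p"
  shows "perp_flow h F p = F p \<longleftrightarrow> quasi_umbilic h \<nu> p"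
proof -
  let ?A = "shape_operator h \<nu> p"
  obtain v c where v: "v \<noteq> 0" "?A v = c *\<^sub>R v" "F p = span {v}"
    using principal unfolding principal_direction_def eigenvector_of_def by blast
  then have eigen: "eigenvector_of ?A v"
    by (auto simp: eigenvector_of_def)
  let ?w = "perp_vector (induced_metric h p) v"
  note A = shape_operator(1)[OF p] shape_operator_selfadjoint[OF p]
  have not_scalar: "\<not> (\<exists>c. \<forall>v. ?A v = c *\<^sub>R v)"
    using assms by (simp add: umbilic_def)
  have "perp_flow h F p = F p \<longleftrightarrow> span {?w} = span {v}"
    using perp_flow_span[of p F v, OF p v(3,1)] v(3) by simp
  also have "\<dots> \<longleftrightarrow> ?w \<in> span {v}"
    using span_singleton_eq[OF _ perp_vector_nonzero[OF v(1)]] span_base[of ?w "{?w}"] by blast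
  also have "\<dots> \<longleftrightarrow> quasi_umbilic h \<nu> p"
  proof
    assume null: "?w \<in> span {v}"
    show "quasi_umbilic h \<nu> p"
      unfolding quasi_umbilic_def Let_def
      using charpoly_double_root_if_null[OF A v(1,2) null not_scalar]
        not_diagonalizable_if_null[OF A v(1,2) null not_scalar] by blast
  next
    assume "quasi_umbilic h \<nu> p"
    then show "?w \<in> span {v}"
      unfolding quasi_umbilic_def Let_def
      by (intro perp_vector_dependent_if_not_diagonalizable[OF A eigen]) (rule conjunct2)
  qed
  finally show ?thesis .
qed

end

end

section \<open>The index of the orthogonal flow\<close>

text \<open>With Gram matrix entries \<open>E\<close>, \<open>F\<close>, \<open>G\<close>, the left
  side is \<open>perp_vector\<close> of the unit vector with angle \<open>\<theta>\<close>; the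
  right side splits it into a complex linear and a conjugate linear part.\<close>

lemma rotate_metric_complex:
  fixes E F G \<theta> :: real
  defines "\<sigma> \<equiv> Complex ((E - G) / 2) F" and "\<tau> \<equiv> complex_of_real ((E + G) / 2)"
  shows "Complex (- (cos \<theta> * F + sin \<theta> * G)) (cos \<theta> * E + sin \<theta> * F) = \<i> * (\<tau> * cis \<theta> + \<sigma> * cis (- \<theta>))"
  unfolding \<sigma>_def \<tau>_def by (simp add: complex_eq_iff field_simps)

text \<open>The squares of the two sides differ by \<open>F\<^sup>2 - E * G\<close>, minus the Gram
  determinant.\<close>

lemma lorentzian_beltrami_bound:
  fixes E F G :: real
  assumes "E * G < F\<^sup>2"
  shows "\<bar>(E + G) / 2\<bar> < cmod (Complex ((E - G) / 2) F)"
proof (rule power2_less_imp_less)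
  have "((E + G) / 2)\<^sup>2 = ((E - G) / 2)\<^sup>2 + E * G"
    by (simp add: power2_eq_square field_simps)
  also have "\<dots> < (cmod (Complex ((E - G) / 2) F))\<^sup>2"
    using assms by (simp add: cmod_power2)
  finally show "\<bar>(E + G) / 2\<bar>\<^sup>2 < (cmod (Complex ((E - G) / 2) F))\<^sup>2"
    by (simp only: power2_abs)
qed simp

text \<open>The unit disc about 1 lies in the right half-plane, where \<open>Arg\<close> is
  continuous; factors of this kind contribute no winding.\<close>

lemma not_nonpos_Reals_near_1:
  assumes "cmod z < 1"
  shows "1 + z \<notin> \<real>\<^sub>\<le>\<^sub>0" and "1 + z \<noteq> 0"
proof -
  have "\<bar>Re z\<bar> < 1"
    using assms abs_Re_le_cmod[of z] by simp
  then show "1 + z \<notin> \<real>\<^sub>\<le>\<^sub>0"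
    by (auto simp: complex_nonpos_Reals_iff)
  then show "1 + z \<noteq> 0"
    by auto
qed

text \<open>Identifying the plane with \<open>\<complex>\<close>, the map \<open>perp_vector g\<close> is
  \<open>z \<mapsto> \<i> (\<tau> z + \<sigma> cnj z)\<close>, and \<open>g\<close> being Lorentzian means \<open>\<bar>\<tau>\<bar> < \<bar>\<sigma>\<bar>\<close>. So the direction with angle
  \<open>\<theta>\<close> goes to \<open>\<i> \<sigma> cis (- \<theta>) (1 + \<tau>/\<sigma> cis (2 \<theta>))\<close>, where the last factor has positive real part
  and \<open>\<sigma>\<close> is nearly constant close to the center: only \<open>- \<theta>\<close> contributes to the index.\<close>

lemma has_index_perp_vector:
  fixes g :: "real^2 \<Rightarrow> real^2 \<Rightarrow> real^2 \<Rightarrow> real" and n :: int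
  assumes "open U" "p \<in> U"
    and lorentzian: "\<And>q. q \<in> U \<Longrightarrow> lorentzian_form (g q)"
    and continuous: "\<And>a b. continuous_on U (\<lambda>q. g q a b)"
    and index: "has_index F p (of_int n / 2)"
    and F': "\<And>q v. \<lbrakk>q \<in> U; q \<noteq> p; F q = span {v}; v \<noteq> 0\<rbrakk> \<Longrightarrow> F' q = span {perp_vector (g q) v}"
  shows "has_index F' p (- of_int n / 2)"
proof -
  define \<sigma> where "\<sigma> q = Complex ((g q (axis 1 1) (axis 1 1) - g q (axis 2 1) (axis 2 1)) / 2) (g q (axis 1 1) (axis 2 1))" for q
  define \<tau> where "\<tau> q = complex_of_real ((g q (axis 1 1) (axis 1 1) + g q (axis 2 1) (axis 2 1)) / 2)" for q
  have bound: "cmod (\<tau> q) < cmod (\<sigma> q)" if "q \<in> U" for q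
    unfolding \<sigma>_def \<tau>_def norm_of_real
    by (rule lorentzian_beltrami_bound[OF lorentzian_form.det_neg[OF lorentzian[OF that]]])
  then have \<sigma>_nonzero: "\<sigma> q \<noteq> 0" if "q \<in> U" for q
    using that by fastforce
  have cont: "continuous_on U \<sigma>" "continuous_on U \<tau>"
    unfolding \<sigma>_def \<tau>_def Complex_eq by (intro continuous_intros continuous; simp)+
  obtain \<epsilon> where \<epsilon>: "\<epsilon> > 0" and angle: "\<And>\<rho>. \<lbrakk>0 < \<rho>; \<rho> < \<epsilon>\<rbrakk> \<Longrightarrow>
      \<exists>\<theta>::real \<Rightarrow> real. continuous_on {0..2 * pi} \<theta> \<and>
          (\<forall>t\<in>{0..2 * pi}.
             F (p + \<rho> *\<^sub>R vector [cos t, sin t]) = span {vector [cos (\<theta> t), sin (\<theta> t)]}) \<and>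
          (\<theta> (2 * pi) - \<theta> 0) / (2 * pi) = of_int n / 2"
    using index unfolding has_index_def by blast
  \<comment> \<open>Where \<open>\<sigma>\<close> stays closer to \<open>\<sigma> p\<close> than 0
    does, it cannot wind around 0.\<close>
  have "\<forall>\<^sub>F q in nhds p. q \<in> U \<and> dist (\<sigma> q) (\<sigma> p) < cmod (\<sigma> p)"
  proof (intro eventually_conj eventually_nhds_in_open assms(1,2))
    have "(\<sigma> \<longlongrightarrow> \<sigma> p) (nhds p)"
      using cont(1) assms(1,2) by (simp add: continuous_on_eq_continuous_at isCont_def tendsto_nhds_iff)
    then show "\<forall>\<^sub>F q in nhds p. dist (\<sigma> q) (\<sigma> p) < cmod (\<sigma> p)"
      using tendstoD \<sigma>_nonzero[OF assms(2)] by (metis zero_less_norm_iff)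
  qed
  then obtain \<delta> where \<delta>: "\<delta> > 0"
    "\<And>q. dist q p < \<delta> \<Longrightarrow> q \<in> U \<and> dist (\<sigma> q) (\<sigma> p) < cmod (\<sigma> p)"
    unfolding eventually_nhds_metric by blast
  show ?thesis
    unfolding has_index_def
  proof (intro exI[of _ "min \<epsilon> \<delta>"] conjI allI impI)
    show "0 < min \<epsilon> \<delta>"
      using \<epsilon> \<delta> by simp
    fix \<rho> :: real assume \<rho>: "0 < \<rho> \<and> \<rho> < min \<epsilon> \<delta>"
    then obtain \<theta> where \<theta>: "continuous_on {0..2 * pi} \<theta>"
      "\<And>t. t \<in> {0..2 * pi} \<Longrightarrow>
        F (p + \<rho> *\<^sub>R vector [cos t, sin t]) = span {vector [cos (\<theta> t), sin (\<theta> t)]}"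
      "(\<theta> (2 * pi) - \<theta> 0) / (2 * pi) = of_int n / 2"
      using angle[of \<rho>] by auto
    define c where "c t = p + \<rho> *\<^sub>R (vector [cos t, sin t] :: real^2)" for t
    have norm_unit: "norm (vector [cos t, sin t] :: real^2) = 1" for t
      by (simp add: norm_vec_def L2_set_def sum_2)
    have dist_c: "dist (c t) p = \<rho>" for t
      using \<rho> by (simp add: c_def dist_norm norm_unit)
    have c: "c t \<in> U" "dist (\<sigma> (c t)) (\<sigma> p) < cmod (\<sigma> p)" "c t \<noteq> p" for t
      using \<delta>(2)[of "c t"] dist_c[of t] \<rho> by auto
    have cont_c: "continuous_on {0..2 * pi} c"
      unfolding c_def vector_2_axis by (intro continuous_intros)
    have cont_\<sigma>: "continuous_on {0..2 * pi} (\<lambda>t. \<sigma> (c t))" and cont_\<tau>: "continuous_on {0..2 * pi} (\<lambda>t. \<tau> (c t))"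
      using continuous_on_compose2[OF cont(1) cont_c] continuous_on_compose2[OF cont(2) cont_c] c by auto
    \<comment> \<open>\<open>z\<close> compares the complex linear part with the conjugate linear
      one, \<open>y\<close> is the relative deviation of \<open>\<sigma>\<close> from its central
      value; both stay in the open unit disc.\<close>
    define z where "z t = \<tau> (c t) / \<sigma> (c t) * cis (2 * \<theta> t)" for t
    define y where "y t = (\<sigma> (c t) - \<sigma> p) / \<sigma> p" for t
    have z: "cmod (z t) < 1" for t
      using bound[OF c(1)] \<sigma>_nonzero[OF c(1)] by (simp add: z_def norm_mult norm_divide)
    have y: "cmod (y t) < 1" for t
      using c(2)[of t] \<sigma>_nonzero[OF \<open>p \<in> U\<close>] by (simp add: y_def norm_divide dist_norm)
    \<comment> \<open>One summand for each factor of \<open>\<i> * \<sigma> p * (1 + y t) * cis (-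
      \<theta> t) * (1 + z t)\<close>; only \<open>- \<theta> t\<close> can change over a full
      turn.\<close>
    define \<psi> where "\<psi> t = pi / 2 + Arg (\<sigma> p) + Arg (1 + y t) - \<theta> t + Arg (1 + z t)" for t
    define R where "R t = cmod (\<sigma> p) * cmod (1 + y t) * cmod (1 + z t)" for t
    have "cis (\<psi> t) = \<i> * cis (Arg (\<sigma> p)) * cis (Arg (1 + y t)) * cis (- \<theta> t) * cis (Arg (1 + z t))" for t
      unfolding \<psi>_def by (simp only: diff_conv_add_uminus cis_mult[symmetric] cis_pi_half)
    then have "of_real (R t) * cis (\<psi> t) = \<i> * (of_real (cmod (\<sigma> p)) * cis (Arg (\<sigma> p)))
        * (of_real (cmod (1 + y t)) * cis (Arg (1 + y t))) * cis (- \<theta> t)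
        * (of_real (cmod (1 + z t)) * cis (Arg (1 + z t)))" for t
      by (simp add: R_def)
    also have "\<dots> t = \<i> * (\<sigma> p * (1 + y t)) * cis (- \<theta> t) * (1 + z t)" for t
      using rcis_cmod_Arg[of "\<sigma> p"] rcis_cmod_Arg[of "1 + y t"] rcis_cmod_Arg[of "1 + z t"]
      by (simp add: rcis_def)
    finally have polar: "of_real (R t) * cis (\<psi> t) = \<i> * (\<sigma> p * (1 + y t)) * cis (- \<theta> t) * (1 + z t)" for t .
    have "\<sigma> p * (1 + y t) = \<sigma> (c t)" for t
      using \<sigma>_nonzero[OF \<open>p \<in> U\<close>] by (simp add: y_def field_simps)
    moreover have "cis (- \<theta> t) * cis (2 * \<theta> t) = cis (\<theta> t)" for t
      by (simp add: cis_mult)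
    then have "\<sigma> (c t) * (cis (- \<theta> t) * (1 + z t)) = \<tau> (c t) * cis (\<theta> t) + \<sigma> (c t) * cis (- \<theta> t)" for t
      using \<sigma>_nonzero[OF c(1)] by (simp add: z_def field_simps)
    ultimately have polar: "of_real (R t) * cis (\<psi> t) = \<i> * (\<tau> (c t) * cis (\<theta> t) + \<sigma> (c t) * cis (- \<theta> t))" for t
      unfolding polar by (metis mult.assoc)
    have R: "R t > 0" for t
      using \<sigma>_nonzero[OF \<open>p \<in> U\<close>] not_nonpos_Reals_near_1(2) y z by (simp add: R_def)
    have direction: "perp_vector (g (c t)) (vector [cos (\<theta> t), sin (\<theta> t)]) = R t *\<^sub>R vector [cos (\<psi> t), sin (\<psi> t)]" for t
    proof -
      interpret lorentzian_form "g (c t)"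
        by (rule lorentzian[OF c(1)])
      have "Complex (perp_vector (g (c t)) (vector [cos (\<theta> t), sin (\<theta> t)]) $ 1)
          (perp_vector (g (c t)) (vector [cos (\<theta> t), sin (\<theta> t)]) $ 2) = of_real (R t) * cis (\<psi> t)"
        unfolding polar \<sigma>_def \<tau>_def rotate_metric_complex[symmetric]
        by (simp add: perp_vector_def expand_left[of "vector _"] commute[of "axis 2 1" "axis 1 1"])
      then show ?thesis
        by (simp add: complex_eq_iff vec_eq_iff forall_2)
    qed
    show "\<exists>\<psi>. continuous_on {0..2 * pi} \<psi> \<and>
        (\<forall>t\<in>{0..2 * pi}. F' (p + \<rho> *\<^sub>R vector [cos t, sin t]) = span {vector [cos (\<psi> t), sin (\<psi> t)]}) \<and>
        (\<psi> (2 * pi) - \<psi> 0) / (2 * pi) = - of_int n / 2"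
    proof (intro exI[of _ \<psi>] conjI ballI)
      have "continuous_on {0..2 * pi} y"
        unfolding y_def using cont_\<sigma> \<sigma>_nonzero[OF \<open>p \<in> U\<close>] by (intro continuous_intros) auto
      moreover have "continuous_on {0..2 * pi} z"
        unfolding z_def using cont_\<sigma> cont_\<tau> \<sigma>_nonzero[OF c(1)] \<theta>(1) by (intro continuous_intros) auto
      ultimately show "continuous_on {0..2 * pi} \<psi>"
        unfolding \<psi>_def using not_nonpos_Reals_near_1(1) y z \<theta>(1) by (intro continuous_intros) auto
    next
      fix t assume "t \<in> {0..2 * pi}"
      let ?v = "vector [cos (\<theta> t), sin (\<theta> t)] :: real^2" and ?w = "vector [cos (\<psi> t), sin (\<psi> t)] :: real^2"
      have "?v \<noteq> 0"
        using norm_unit[of "\<theta> t"] by auto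
      then have "F' (c t) = span {R t *\<^sub>R ?w}"
        using F'[OF c(1,3)] \<theta>(2)[OF \<open>t \<in> _\<close>] by (simp add: direction flip: c_def)
      also have "\<dots> = span {?w}"
        using R[of t] norm_unit[of "\<psi> t"] by (intro span_singleton_eq) (auto simp: span_scale span_base)
      finally show "F' (p + \<rho> *\<^sub>R vector [cos t, sin t]) = span {?w}"
        by (simp add: c_def)
    next
      have "c (2 * pi) = c 0"
        by (simp add: c_def)
      \<comment> \<open>For odd \<open>n\<close> the angle itself changes by an odd multiple of
        \<open>pi\<close>, but \<open>z\<close> involves only the doubled angle and so closes
        up.\<close>
      moreover have "2 * \<theta> (2 * pi) = 2 * \<theta> 0 + 2 * pi * of_int n"
        using \<theta>(3) by (simp add: field_simps)
      then have "cis (2 * \<theta> (2 * pi)) = cis (2 * \<theta> 0)"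
        by (simp only: cis_mult[symmetric]) (simp add: cis_multiple_2pi)
      ultimately have "\<psi> (2 * pi) - \<psi> 0 = - (\<theta> (2 * pi) - \<theta> 0)"
        by (simp add: \<psi>_def y_def z_def)
      then show "(\<psi> (2 * pi) - \<psi> 0) / (2 * pi) = - of_int n / 2"
        using \<theta>(3) by (simp add: field_simps)
    qed
  qed
qed

section \<open>Ribaucour's parametrization\<close>

lemma vector_3_axis:
  "(vector [a, b, c] :: real^3) = a *\<^sub>R axis 1 1 + b *\<^sub>R axis 2 1 + c *\<^sub>R axis 3 1"
  by (simp add: vec_eq_iff forall_3 axis_def)

text \<open>The restriction of \<open>lorentz\<close> to the vectors with first coordinate
  zero.\<close>

definition minkowski_plane :: "real^2 \<Rightarrow> real^2 \<Rightarrow> real" where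
  "minkowski_plane x y = x$1 * y$1 - x$2 * y$2"

text \<open>\<open>P\<close> sends \<open>(d\<xi>, d\<eta>)\<close> to the projection along \<open>\<nu>\<close> of the tangent vector \<open>(d\<mu>, d\<xi>, d\<eta>)\<close> of the graph
  of \<open>\<mu>\<close> (the surface of the centers of the enveloped spheres), and \<open>N\<close> is
  \<open>2 / ribaucour_denominator \<mu> p\<close> times the Hessian of \<open>\<mu>\<close> with its first row negated.\<close>

lemma ribaucour_derivatives:
  assumes "open V" "p \<in> V" and \<mu>: "C_on \<infinity> \<mu> V"
    and nonzero: "\<And>q. q \<in> V \<Longrightarrow> ribaucour_denominator \<mu> q \<noteq> 0"
  obtains P N where "linear P" "(ribaucour_normal \<mu> has_derivative (\<lambda>x. P (N x))) (at p)"
    "(ribaucour_surface \<mu> has_derivative (\<lambda>x. P (x - \<mu> p *\<^sub>R N x))) (at p)"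
    "\<And>x y. lorentz (P x) (P y) = minkowski_plane x y"
    "\<And>x. lorentz (ribaucour_normal \<mu> p) (P x) = 0"
    "lorentz (ribaucour_normal \<mu> p) (ribaucour_normal \<mu> p) = 1"
    "\<And>x y. minkowski_plane (N x) y = minkowski_plane x (N y)"
proof -
  define a where "a q = frechet_derivative \<mu> (at q) (axis 1 1)" for q
  define b where "b q = frechet_derivative \<mu> (at q) (axis 2 1)" for q
  define D where "D = ribaucour_denominator \<mu>"
  have D: "D q = - 1 - (a q)\<^sup>2 + (b q)\<^sup>2" for q
    by (simp add: D_def ribaucour_denominator_def a_def b_def)
  have D_nonzero: "D q \<noteq> 0" if "q \<in> V" for q
    using nonzero[OF that] by (simp add: D_def)
  \<comment> \<open>Lorentz-normal to the graph of \<open>\<mu>\<close> (placed as first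
    coordinate), with \<open>lorentz (k q) (k q) = - D q\<close>. By \<open>normal_eq\<close> below,
    Ribaucour's normal is the mirror image of \<open>vector [1, 0, 0]\<close> in the tangent plane
    of that graph.\<close>
  define k where "k q = (vector [1, - a q, b q] :: real^3)" for q
  define a' where "a' = frechet_derivative a (at p)"
  define b' where "b' = frechet_derivative b (at p)"
  have d\<mu>: "(\<mu> has_derivative frechet_derivative \<mu> (at p)) (at p)"
    using C_on_differentiable[OF \<mu> _ \<open>p \<in> V\<close>] by (simp add: frechet_derivative_works[symmetric])
  have da: "(a has_derivative a') (at p)" and db: "(b has_derivative b') (at p)"
    using C_on_differentiable[OF C_on_frechet_derivative[OF \<mu>] _ \<open>p \<in> V\<close>]
    by (simp_all add: a'_def b'_def a_def[abs_def] b_def[abs_def] frechet_derivative_works[symmetric])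
  have \<mu>'_eq: "frechet_derivative \<mu> (at p) x = x$1 * a p + x$2 * b p" for x
    using linear_add[OF has_derivative_linear[OF d\<mu>]] linear_scale[OF has_derivative_linear[OF d\<mu>]]
    by (subst vec2_decompose[of x]) (simp add: a_def b_def)
  have a'_eq: "a' x = x$1 * a' (axis 1 1) + x$2 * a' (axis 2 1)" for x
    using linear_add[OF has_derivative_linear[OF da]] linear_scale[OF has_derivative_linear[OF da]]
    by (subst vec2_decompose[of x]) simp
  have b'_eq: "b' x = x$1 * b' (axis 1 1) + x$2 * b' (axis 2 1)" for x
    using linear_add[OF has_derivative_linear[OF db]] linear_scale[OF has_derivative_linear[OF db]]
    by (subst vec2_decompose[of x]) simp
  have schwarz: "a' (axis 2 1) = b' (axis 1 1)"
    using second_derivative_symmetric[OF \<open>open V\<close> \<open>p \<in> V\<close> \<mu>]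
    by (simp add: a'_def b'_def a_def[abs_def] b_def[abs_def])
  \<comment> \<open>The same reflection applied to \<open>vector [0, y$1, y$2]\<close>; hence
    \<open>P\<close> is isometric and its values are orthogonal to the normal.\<close>
  define P where "P y = vector [0, y$1, y$2] - (2 * (a p * y$1 + b p * y$2) / D p) *\<^sub>R k p" for y :: "real^2"
  define N where "N x = (vector [- (2 / D p) * a' x, (2 / D p) * b' x] :: real^2)" for x
  have normal_eq: "ribaucour_normal \<mu> q = vector [1, 0, 0] + (2 / D q) *\<^sub>R k q" if "q \<in> V" for q
    using D_nonzero[OF that] unfolding ribaucour_normal_def Let_def D_def[symmetric] a_def[symmetric] b_def[symmetric]
    by (simp add: vec_eq_iff forall_3 k_def D field_simps)
  have Dp: "D p \<noteq> 0"
    using D_nonzero[OF \<open>p \<in> V\<close>] .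
  have dD: "(D has_derivative (\<lambda>x. - 2 * a p * a' x + 2 * b p * b' x)) (at p)"
    unfolding D[abs_def] by (auto intro!: derivative_eq_intros da db)
  have dk: "(k has_derivative (\<lambda>x. vector [0, - a' x, b' x])) (at p)"
    unfolding k_def[abs_def] vector_3_axis by (auto intro!: derivative_eq_intros da db)
  have "((\<lambda>q. vector [1, 0, 0] + (2 / D q) *\<^sub>R k q) has_derivative
      (\<lambda>x. (2 / D p) *\<^sub>R vector [0, - a' x, b' x]
        + (- 2 * (- 2 * a p * a' x + 2 * b p * b' x) / (D p)\<^sup>2) *\<^sub>R k p)) (at p)"
    by (auto intro!: derivative_eq_intros dD dk Dp simp: power2_eq_square divide_simps)
  moreover have "(2 / D p) *\<^sub>R vector [0, - a' x, b' x]
        + (- 2 * (- 2 * a p * a' x + 2 * b p * b' x) / (D p)\<^sup>2) *\<^sub>R k p = P (N x)" for x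
    using Dp by (simp add: P_def N_def k_def vec_eq_iff forall_3 power2_eq_square field_simps)
  ultimately have "((\<lambda>q. vector [1, 0, 0] + (2 / D q) *\<^sub>R k q) has_derivative (\<lambda>x. P (N x))) (at p)"
    by simp
  then have d\<nu>: "(ribaucour_normal \<mu> has_derivative (\<lambda>x. P (N x))) (at p)"
    by (rule has_derivative_transform_within_open[OF _ \<open>open V\<close> \<open>p \<in> V\<close>]) (simp add: normal_eq)
  have "linear P"
    by (rule linearI) (simp_all add: P_def vec_eq_iff forall_3 add_divide_distrib algebra_simps)
  moreover note d\<nu>
  moreover have "(ribaucour_surface \<mu> has_derivative (\<lambda>x. P (x - \<mu> p *\<^sub>R N x))) (at p)"
  proof -
    have base: "((\<lambda>q::real^2. vector [0, q$1, q$2] :: real^3) has_derivative (\<lambda>x. vector [0, x$1, x$2])) (at p)"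
      unfolding vector_3_axis
      by (auto intro!: derivative_eq_intros bounded_linear.has_derivative[OF bounded_linear_vec_nth])
    have "(ribaucour_surface \<mu> has_derivative (\<lambda>x. vector [0, x$1, x$2]
        - (\<mu> p *\<^sub>R P (N x) + frechet_derivative \<mu> (at p) x *\<^sub>R ribaucour_normal \<mu> p)
        + frechet_derivative \<mu> (at p) x *\<^sub>R vector [1, 0, 0])) (at p)"
      unfolding ribaucour_surface_def[abs_def] by (intro derivative_intros base d\<nu> d\<mu>)
    moreover have "vector [0, x$1, x$2]
        - (\<mu> p *\<^sub>R P (N x) + frechet_derivative \<mu> (at p) x *\<^sub>R ribaucour_normal \<mu> p)
        + frechet_derivative \<mu> (at p) x *\<^sub>R vector [1, 0, 0] = P (x - \<mu> p *\<^sub>R N x)" for x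
    proof -
      have "P (x - \<mu> p *\<^sub>R N x) = P x - \<mu> p *\<^sub>R P (N x)"
        using \<open>linear P\<close> by (simp add: linear_diff linear_scale)
      moreover have "P x = vector [0, x$1, x$2] - frechet_derivative \<mu> (at p) x *\<^sub>R (2 / D p) *\<^sub>R k p"
        by (simp add: P_def \<mu>'_eq add_divide_distrib algebra_simps)
      ultimately show ?thesis
        by (simp add: normal_eq[OF \<open>p \<in> V\<close>] algebra_simps)
    qed
    ultimately show ?thesis
      by simp
  qed
  moreover have "lorentz (P x) (P y) = minkowski_plane x y" for x y
  proof -
    define m where "m y = 2 * (a p * y$1 + b p * y$2) / D p" for y :: "real^2"
    have m: "2 * (a p * y$1 + b p * y$2) = m y * D p" for y
      using Dp by (simp add: m_def)
    have "lorentz (P x) (P y) = x$1 * y$1 - x$2 * y$2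
        + m x * (a p * y$1 + b p * y$2) + m y * (a p * x$1 + b p * x$2) - m x * m y * D p"
      unfolding P_def m_def[symmetric] by (simp add: lorentz_def k_def D power2_eq_square algebra_simps)
    \<comment> \<open>Doubling allows rewriting by \<open>m\<close> without division; the three
      terms with \<open>m\<close> then cancel.\<close>
    also have "2 * \<dots> = 2 * (x$1 * y$1 - x$2 * y$2)
        + m x * (2 * (a p * y$1 + b p * y$2)) + m y * (2 * (a p * x$1 + b p * x$2)) - 2 * m x * m y * D p"
      by (simp add: algebra_simps)
    also have "\<dots> = 2 * (x$1 * y$1 - x$2 * y$2)"
      unfolding m by (simp add: algebra_simps)
    finally show ?thesis
      by (simp add: minkowski_plane_def)
  qed
  moreover have "lorentz (ribaucour_normal \<mu> p) (P x) = 0" for x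
    using Dp unfolding normal_eq[OF \<open>p \<in> V\<close>] P_def
    by (simp add: lorentz_def k_def field_simps) (simp add: D power2_eq_square algebra_simps)
  moreover have "lorentz (ribaucour_normal \<mu> p) (ribaucour_normal \<mu> p) = 1"
    using Dp unfolding normal_eq[OF \<open>p \<in> V\<close>]
    by (simp add: lorentz_def k_def field_simps) (simp add: D power2_eq_square algebra_simps)
  \<comment> \<open>Both sides are \<open>- 2 / D p\<close> times the Hessian of
    \<open>\<mu>\<close> at \<open>x\<close>, \<open>y\<close>, which is symmetric by
    \<open>schwarz\<close>.\<close>
  moreover have "minkowski_plane (N x) y = minkowski_plane x (N y)" for x y
    unfolding minkowski_plane_def N_def a'_eq[of x] a'_eq[of y] b'_eq[of x] b'_eq[of y] schwarz
    by (simp add: algebra_simps)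
  ultimately show thesis
    using that by blast
qed

section \<open>Comparison of a surface with its Ribaucour form\<close>

text \<open>A kernel vector would be orthogonal to everything, against nondegeneracy.\<close>

lemma lorentz_isometry_inj:
  assumes "linear L" "\<And>x y. lorentz (L x) (L y) = lorentz x y"
  shows "inj L"
proof (rule injI)
  fix x y assume "L x = L y"
  then have "lorentz (L (x - y)) (L z) = 0" for z
    by (simp add: linear_diff[OF assms(1)] lorentz.zero_left)
  then show "x = y"
    using lorentz_nondegenerate[of "x - y"] assms(2) by simp
qed

lemma minkowski_plane_linear:
  "minkowski_plane (c *\<^sub>R x) y = c * minkowski_plane x y"
  "minkowski_plane x (y - c *\<^sub>R z) = minkowski_plane x y - c * minkowski_plane x z"
  by (simp_all add: minkowski_plane_def algebra_simps)

text \<open>Each vector splits into a multiple of \<open>m\<close> and a part orthogonal to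
  \<open>m\<close>, which \<open>n\<close> annihilates; so \<open>n\<close> and its projection to
  \<open>m\<close> define the same functional.\<close>

lemma normals_of_same_plane:
  assumes "lorentz m m = 1" "lorentz n n = 1"
    and "\<And>y. lorentz m y = 0 \<Longrightarrow> lorentz n y = 0"
  shows "n = lorentz n m *\<^sub>R m" and "(lorentz n m)\<^sup>2 = 1"
proof -
  have "lorentz (n - lorentz n m *\<^sub>R m) y = 0" for y
  proof -
    have "lorentz m (y - lorentz m y *\<^sub>R m) = 0"
      using assms(1) by (simp add: lorentz.diff_right lorentz.scaleR_right)
    then have "lorentz n (y - lorentz m y *\<^sub>R m) = 0"
      by (rule assms(3))
    then show ?thesis
      by (simp add: lorentz.diff_right lorentz.scaleR_right lorentz.diff_left lorentz.scaleR_left)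
  qed
  then show n: "n = lorentz n m *\<^sub>R m"
    using lorentz_nondegenerate[of "n - lorentz n m *\<^sub>R m"] by simp
  have "lorentz n n = lorentz n m * lorentz n m"
    by (subst (2) n) (simp add: lorentz.scaleR_right)
  with assms(2) show "(lorentz n m)\<^sup>2 = 1"
    by (simp add: power2_eq_square)
qed

text \<open>Here \<open>t\<close> stands for \<open>\<mu> p\<close>. Cancelling the injective
  \<open>P\<close> makes a nonzero \<open>x\<close> an eigenvector of \<open>N\<close>;
  self-adjointness then carries the orthogonality of \<open>x\<close> and its coordinate swap over
  to the surface metric.\<close>

lemma ribaucour_principal_orthogonal:
  assumes "linear P" and isometry: "\<And>x y. lorentz (P x) (P y) = minkowski_plane x y"
    and selfadjoint: "\<And>x y. minkowski_plane (N x) y = minkowski_plane x (N y)"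
    and principal: "P (N x) = c *\<^sub>R P (x - t *\<^sub>R N x)"
  shows "lorentz (P (x - t *\<^sub>R N x)) (P (vector [x$2, x$1] - t *\<^sub>R N (vector [x$2, x$1]))) = 0"
proof -
  let ?y = "vector [x$2, x$1] :: real^2"
  have xy: "minkowski_plane x ?y = 0"
    by (simp add: minkowski_plane_def)
  have P_zero: "z = 0" if "P z = 0" for z
    using isometry[of z "axis 1 1"] isometry[of z "axis 2 1"] that
    by (simp add: minkowski_plane_def axis_def vec_eq_iff forall_2 lorentz.zero_left)
  have "P (N x - c *\<^sub>R (x - t *\<^sub>R N x)) = 0"
    using principal by (simp add: linear_diff[OF assms(1)] linear_scale[OF assms(1)])
  from P_zero[OF this] have "(1 + c * t) *\<^sub>R N x = c *\<^sub>R x"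
    by (simp add: algebra_simps)
  \<comment> \<open>If \<open>1 + c * t\<close> vanishes, \<open>c\<close> is nonzero and the
    equation reads \<open>c *\<^sub>R x = 0\<close>.\<close>
  then consider "x = 0" | d where "N x = d *\<^sub>R x"
  proof (cases "1 + c * t = 0")
    case True
    then have "c \<noteq> 0" "c *\<^sub>R x = 0"
      using \<open>(1 + c * t) *\<^sub>R N x = c *\<^sub>R x\<close> by auto
    then show ?thesis
      using that(1) by simp
  next
    case False
    then have "N x = (1 / (1 + c * t)) *\<^sub>R ((1 + c * t) *\<^sub>R N x)"
      by simp
    also have "\<dots> = (c / (1 + c * t)) *\<^sub>R x"
      unfolding \<open>(1 + c * t) *\<^sub>R N x = c *\<^sub>R x\<close> by simp
    finally show ?thesis
      by (rule that(2))
  qed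
  then show ?thesis
  proof cases
    case 1
    have "minkowski_plane (N x) z = 0" for z
      unfolding selfadjoint 1 by (simp add: minkowski_plane_def)
    then show ?thesis
      unfolding isometry 1 using minkowski_plane_linear(1)[of "- t" "N x"] 1 by simp
  next
    case (2 d)
    have "minkowski_plane x (N ?y) = 0"
      unfolding selfadjoint[symmetric] 2 by (simp add: minkowski_plane_linear xy)
    moreover have "x - t *\<^sub>R N x = (1 - t * d) *\<^sub>R x"
      by (simp add: 2 algebra_simps)
    ultimately show ?thesis
      unfolding isometry by (simp add: minkowski_plane_linear xy)
  qed
qed

context oriented_timelike_surface
begin

text \<open>After the congruence and the change of coordinates the surfaces coincide, and the
  normals do up to a sign. Comparing differentials turns the eigenvector equation into the
  hypothesis of \<open>ribaucour_principal_orthogonal\<close>.\<close>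

lemma ribaucour_orthogonal:
  assumes ribaucour: "ribaucour_parametrization h U T V \<phi> \<mu>" and "p \<in> V"
    and principal: "shape_operator h \<nu> (\<phi> p) (frechet_derivative \<phi> (at p) x) = c *\<^sub>R frechet_derivative \<phi> (at p) x"
  shows "induced_metric h (\<phi> p) (frechet_derivative \<phi> (at p) x)
    (frechet_derivative \<phi> (at p) (vector [x$2, x$1])) = 0"
proof -
  let ?R = "ribaucour_surface \<mu>" and ?n = "ribaucour_normal \<mu>"
  obtain L b where "linear L" and L: "\<And>x y. lorentz (L x) (L y) = lorentz x y" and T: "T = (\<lambda>x. L x + b)"
    using ribaucour unfolding ribaucour_parametrization_def lorentz_congruence_def by blast
  have "open V" and \<phi>: "C_on \<infinity> \<phi> V" and inj_\<phi>: "\<And>q. q \<in> V \<Longrightarrow> inj (frechet_derivative \<phi> (at q))"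
    and \<mu>: "C_on \<infinity> \<mu> V" and nonzero: "\<And>q. q \<in> V \<Longrightarrow> ribaucour_denominator \<mu> q \<noteq> 0"
    and \<phi>_U: "\<And>q. q \<in> V \<Longrightarrow> \<phi> q \<in> U" and surface: "\<And>q. q \<in> V \<Longrightarrow> ?R q = L (h (\<phi> q)) + b"
    using ribaucour unfolding ribaucour_parametrization_def T by (auto simp: image_subset_iff)
  note dL = linear_imp_has_derivative[OF \<open>linear L\<close>]
  have d\<phi>: "(\<phi> has_derivative frechet_derivative \<phi> (at q)) (at q)" if "q \<in> V" for q
    using C_on_differentiable[OF \<phi> _ that] by (simp add: frechet_derivative_works[symmetric])
  have dR: "(?R has_derivative (\<lambda>x. L (frechet_derivative h (at (\<phi> q)) (frechet_derivative \<phi> (at q) x)))) (at q)"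
    if "q \<in> V" for q
  proof -
    have "((\<lambda>q. L (h (\<phi> q)) + b) has_derivative
        (\<lambda>x. L (frechet_derivative h (at (\<phi> q)) (frechet_derivative \<phi> (at q) x)))) (at q)"
      using has_derivative_compose[OF has_derivative_compose[OF d\<phi>[OF that] has_derivative(1)[OF \<phi>_U[OF that]]] dL]
      by (intro has_derivative_add_const)
    then show ?thesis
      by (rule has_derivative_transform_within_open[OF _ \<open>open V\<close> that]) (simp add: surface)
  qed
  define m where "m q = L (\<nu> (\<phi> q))" for q
  have dm: "(m has_derivative (\<lambda>x. L (frechet_derivative \<nu> (at (\<phi> p)) (frechet_derivative \<phi> (at p) x)))) (at p)"
    unfolding m_def
    by (rule has_derivative_compose[OF has_derivative_compose[OF d\<phi>[OF \<open>p \<in> V\<close>] has_derivative(2)[OF \<phi>_U[OF \<open>p \<in> V\<close>]]] dL])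
  \<comment> \<open>Both \<open>m\<close> and Ribaucour's normal are unit normals of the same surface, so they agree up to sign.\<close>
  define s where "s q = lorentz (?n q) (m q)" for q
  have normal: "?n q = s q *\<^sub>R m q" "(s q)\<^sup>2 = 1" if q: "q \<in> V" for q
  proof -
    obtain P N where "linear P" "(?n has_derivative (\<lambda>x. P (N x))) (at q)"
      and P: "(?R has_derivative (\<lambda>x. P (x - \<mu> q *\<^sub>R N x))) (at q)"
        "\<And>x y. lorentz (P x) (P y) = minkowski_plane x y"
        "\<And>x. lorentz (?n q) (P x) = 0" "lorentz (?n q) (?n q) = 1"
        "\<And>x y. minkowski_plane (N x) y = minkowski_plane x (N y)"
      by (rule ribaucour_derivatives[OF \<open>open V\<close> q \<mu>]) (erule nonzero, rule that, assumption+)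
    let ?dR = "\<lambda>x. L (frechet_derivative h (at (\<phi> q)) (frechet_derivative \<phi> (at q) x))"
    have "?dR = (\<lambda>x. P (x - \<mu> q *\<^sub>R N x))"
      by (rule has_derivative_unique[OF dR[OF q] P(1)])
    then have ortho: "lorentz (?n q) (?dR x) = 0" for x
      using P(3) by metis
    have m: "lorentz (m q) (m q) = 1"
      by (simp add: m_def L lorentz_normal(1)[OF \<phi>_U[OF q]])
    have "range ?dR = {y. lorentz (m q) y = 0}"
    proof (rule range_eq_lorentz_complement)
      show "linear ?dR"
        by (rule has_derivative_linear[OF dR[OF q]])
      show "inj ?dR"
        using lorentz_isometry_inj[OF \<open>linear L\<close> L] inj_derivative[OF \<phi>_U[OF q]] inj_\<phi>[OF q]
        by (auto simp: inj_def)
      show "m q \<noteq> 0"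
        using m lorentz.zero_left[of 0] by auto
      show "lorentz (m q) (?dR x) = 0" for x
        by (simp add: m_def L lorentz_normal(2)[OF \<phi>_U[OF q]])
    qed
    then have "lorentz (?n q) y = 0" if "lorentz (m q) y = 0" for y
      using ortho that by (metis (mono_tags, lifting) imageE mem_Collect_eq)
    from normals_of_same_plane[OF m P(4) this] show "?n q = s q *\<^sub>R m q" "(s q)\<^sup>2 = 1"
      by (auto simp: s_def)
  qed
  obtain P N where PN: "linear P" "(?n has_derivative (\<lambda>x. P (N x))) (at p)"
    "(?R has_derivative (\<lambda>x. P (x - \<mu> p *\<^sub>R N x))) (at p)"
    "\<And>x y. lorentz (P x) (P y) = minkowski_plane x y"
    "\<And>x. lorentz (?n p) (P x) = 0" "lorentz (?n p) (?n p) = 1"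
    "\<And>x y. minkowski_plane (N x) y = minkowski_plane x (N y)"
    by (rule ribaucour_derivatives[OF \<open>open V\<close> \<open>p \<in> V\<close> \<mu>]) (erule nonzero, rule that, assumption+)
  have dR_eq: "L (frechet_derivative h (at (\<phi> p)) (frechet_derivative \<phi> (at p) x)) = P (x - \<mu> p *\<^sub>R N x)" for x
    using has_derivative_unique[OF dR[OF \<open>p \<in> V\<close>] PN(3)] by metis
  obtain s' where ds: "(s has_derivative s') (at p)"
    using lorentz.FDERIV[OF PN(2) dm] unfolding s_def[symmetric] by blast
  \<comment> \<open>As \<open>s\<close> squares to 1 on all of \<open>V\<close>, its derivative
    vanishes, and the differentials of the two normals agree up to the factor
    \<open>s p\<close>.\<close>
  have "2 * s p * s' x = 0"
  proof (rule has_derivative_of_constant_eq_zero[OF _ \<open>open V\<close> \<open>p \<in> V\<close> normal(2)])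
    show "((\<lambda>q. (s q)\<^sup>2) has_derivative (\<lambda>x. 2 * s p * s' x)) (at p)"
      by (auto intro!: derivative_eq_intros ds)
  qed
  then have "s' x = 0"
    using normal(2)[OF \<open>p \<in> V\<close>] by auto
  have "((\<lambda>q. s q *\<^sub>R m q) has_derivative
      (\<lambda>x. s p *\<^sub>R L (frechet_derivative \<nu> (at (\<phi> p)) (frechet_derivative \<phi> (at p) x)) + s' x *\<^sub>R m p)) (at p)"
    by (rule has_derivative_scaleR[OF ds dm])
  then have "(?n has_derivative
      (\<lambda>x. s p *\<^sub>R L (frechet_derivative \<nu> (at (\<phi> p)) (frechet_derivative \<phi> (at p) x)) + s' x *\<^sub>R m p)) (at p)"
    by (rule has_derivative_transform_within_open[OF _ \<open>open V\<close> \<open>p \<in> V\<close>]) (simp add: normal(1)[symmetric])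
  from has_derivative_unique[OF PN(2) this]
  have "P (N x) = s p *\<^sub>R L (frechet_derivative \<nu> (at (\<phi> p)) (frechet_derivative \<phi> (at p) x)) + s' x *\<^sub>R m p"
    by (rule fun_cong)
  also have "\<dots> = (- (s p * c)) *\<^sub>R L (frechet_derivative h (at (\<phi> p)) (frechet_derivative \<phi> (at p) x))"
    using linear_derivative(1)[OF \<phi>_U[OF \<open>p \<in> V\<close>]] \<open>linear L\<close>
    by (simp add: \<open>s' x = 0\<close> shape_operator(2)[OF \<phi>_U[OF \<open>p \<in> V\<close>]] principal linear_scale linear_neg)
  finally have "P (N x) = (- (s p * c)) *\<^sub>R P (x - \<mu> p *\<^sub>R N x)"
    unfolding dR_eq .
  from ribaucour_principal_orthogonal[OF PN(1,4,7) this] show ?thesis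
    unfolding dR_eq[symmetric] L induced_metric_def .
qed

text \<open>The complement is a line, so any nonzero vector orthogonal to the generator spans it;
  swapping the coordinates keeps the vector nonzero.\<close>

lemma perp_flow_ribaucour:
  assumes "ribaucour_parametrization h U T V \<phi> \<mu>" "p \<in> V"
    and "principal_direction h \<nu> (\<phi> p) (F (\<phi> p))"
    and F: "F (\<phi> p) = span {frechet_derivative \<phi> (at p) (vector [u, v])}"
  shows "perp_flow h F (\<phi> p) = span {frechet_derivative \<phi> (at p) (vector [v, u])}"
proof -
  let ?x = "frechet_derivative \<phi> (at p) (vector [u, v])" and ?y = "frechet_derivative \<phi> (at p) (vector [v, u])"
  have U: "\<phi> p \<in> U" and d\<phi>: "C_on \<infinity> \<phi> V" "inj (frechet_derivative \<phi> (at p))"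
    using assms(1,2) unfolding ribaucour_parametrization_def by auto
  interpret lorentzian_form "induced_metric h (\<phi> p)"
    by (rule induced_metric_lorentzian[OF U])
  have "linear (frechet_derivative \<phi> (at p))"
    using C_on_differentiable[OF d\<phi>(1) _ assms(2)] by (simp add: linear_frechet_derivative)
  then have zero: "frechet_derivative \<phi> (at p) w = 0 \<longleftrightarrow> w = 0" for w
    using d\<phi>(2) by (metis injD linear_0)
  obtain w c where w: "w \<noteq> 0" "shape_operator h \<nu> (\<phi> p) w = c *\<^sub>R w" "span {?x} = span {w}"
    using assms(3) unfolding principal_direction_def eigenvector_of_def F by blast
  then have "?x \<noteq> 0"
    using span_base[of w "{w}"] by auto
  moreover have "?x \<in> span {w}"
    using span_base[of ?x "{?x}"] w(3) by simp
  then obtain k where k: "?x = k *\<^sub>R w"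
    by (auto simp: span_singleton)
  \<comment> \<open>The eigenvector \<open>w\<close> is only known to span the same line, so its
    eigenvalue is passed on to the multiple \<open>?x\<close>.\<close>
  have "shape_operator h \<nu> (\<phi> p) ?x = c *\<^sub>R ?x"
    by (simp add: k linear_scale[OF shape_operator(1)[OF U]] w(2))
  from ribaucour_orthogonal[OF assms(1,2) this] have "induced_metric h (\<phi> p) ?x ?y = 0"
    by simp
  ultimately have "?y \<in> span {perp_vector (induced_metric h (\<phi> p)) ?x}"
    using complement_eq_span by blast
  moreover have "?y \<noteq> 0"
    using \<open>?x \<noteq> 0\<close> unfolding zero by (auto simp: vec_eq_iff forall_2)
  ultimately show ?thesis
    using perp_flow_span[of "\<phi> p" F ?x, OF U F \<open>?x \<noteq> 0\<close>] span_singleton_eq by metis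
qed

end

theorem propositionC:
  fixes U :: "(real^2) set" and h \<nu> :: "real^2 \<Rightarrow> real^3"
    and F :: "real^2 \<Rightarrow> (real^2) set" and n :: int
  assumes "open U" and "0 \<in> U"
    and "timelike_surface h U" and "unit_normal_field h \<nu> U"
    and "\<forall>p\<in>U - {0}. \<not> umbilic h \<nu> p"
    and "C_curvature_line_flow 1 h \<nu> (U - {0}) F"
    and "has_index F 0 (of_int n / 2)"
  shows "C_curvature_line_flow 1 h \<nu> (U - {0}) (perp_flow h F)
    \<and> (\<forall>p\<in>U - {0}. perp_flow h F p = F p \<longleftrightarrow> quasi_umbilic h \<nu> p)
    \<and> (\<forall>p\<in>U - {0}. perp_flow h (perp_flow h F) p = F p)
    \<and> (\<forall>T V \<phi> \<mu>. ribaucour_parametrization h U T V \<phi> \<mu> \<longrightarrow>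
          (\<forall>p\<in>V - {0}. \<forall>u v::real.
             F (\<phi> p) = span {frechet_derivative \<phi> (at p) (vector [u, v])} \<longrightarrow>
             perp_flow h F (\<phi> p) = span {frechet_derivative \<phi> (at p) (vector [v, u])}))
    \<and> has_index (perp_flow h F) 0 (- of_int n / 2)
    \<and> (\<forall>r\<ge>1. C_curvature_line_flow r h \<nu> (U - {0}) F \<longrightarrow>
          C_curvature_line_flow r h \<nu> (U - {0}) (perp_flow h F))"
proof (intro conjI ballI allI impI)
  interpret oriented_timelike_surface h \<nu> U
    using assms by unfold_locales
  have principal: "principal_direction h \<nu> p (F p)" if "p \<in> U - {0}" for p
    using assms(6) that by (simp add: C_curvature_line_flow_def)
  have flow: "C_curvature_line_flow r h \<nu> (U - {0}) (perp_flow h F)"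
    if "C_curvature_line_flow r h \<nu> (U - {0}) F" for r
    using that principal unfolding C_curvature_line_flow_def
    by (auto intro: C_direction_field_perp_flow principal_direction_perp_flow)
  show "C_curvature_line_flow 1 h \<nu> (U - {0}) (perp_flow h F)"
    by (rule flow[OF assms(6)])
  show "C_curvature_line_flow r h \<nu> (U - {0}) (perp_flow h F)"
    if "C_curvature_line_flow r h \<nu> (U - {0}) F" for r
    by (rule flow[OF that])
  show "perp_flow h F p = F p \<longleftrightarrow> quasi_umbilic h \<nu> p" if "p \<in> U - {0}" for p
    using that assms(5) principal[OF that] by (intro perp_flow_eq_iff_quasi_umbilic) auto
  show "perp_flow h (perp_flow h F) p = F p" if "p \<in> U - {0}" for p
    using that principal[OF that] by (intro perp_flow_perp_flow) auto
  show "perp_flow h F (\<phi> p) = span {frechet_derivative \<phi> (at p) (vector [v, u])}"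
    if ribaucour: "ribaucour_parametrization h U T V \<phi> \<mu>" and p: "p \<in> V - {0}"
      and F: "F (\<phi> p) = span {frechet_derivative \<phi> (at p) (vector [u, v])}" for T V \<phi> \<mu> p u v
  proof (rule perp_flow_ribaucour[of T V \<phi> \<mu> p F, OF ribaucour _ principal F])
    \<comment> \<open>Principality holds off the origin; \<open>\<phi>\<close> is injective and
      fixes 0, so \<open>\<phi> p\<close> avoids it.\<close>
    have "inj_on \<phi> V" "0 \<in> V" "\<phi> ` V \<subseteq> U" "\<phi> 0 = 0"
      using ribaucour unfolding ribaucour_parametrization_def by blast+
    then show "\<phi> p \<in> U - {0}"
      using p inj_on_eq_iff[of \<phi> V p 0] by auto
  qed (use p in simp)
  show "has_index (perp_flow h F) 0 (- of_int n / 2)"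
  proof (rule has_index_perp_vector[OF assms(1,2) _ _ assms(7)])
    show "lorentzian_form (induced_metric h q)" if "q \<in> U" for q
      by (rule induced_metric_lorentzian[OF that])
    show "continuous_on U (\<lambda>q. induced_metric h q a b)" for a b
      by (rule C_on_continuous_on[OF C_on_induced_metric])
    show "perp_flow h F q = span {perp_vector (induced_metric h q) v}"
      if "q \<in> U" "F q = span {v}" "v \<noteq> 0" for q v
      by (rule perp_flow_span[of q F v, OF that])
  qed
qed

end
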